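(* In the erasure model with parameter $\gamma$ there is a randomized algorithm for PARTITION on $n$ elements such that, with probability at least $1-1/\mathrm{poly}(n)$, it has query complexity $O(n/\gamma)$, round complexity $\log^*(n)+8$, and solves PARTITION.
   Context: Setting. The input is a set of $n$ elements with an unknown total order, presented in uniformly random order (the elements are a priori indistinguishable). PARTITION (with cutoff the median, $k=n/2$): output a partition of the elements into a set $A$ (accepted) and a set $R$ (rejected); the problem is solved if every element above the median is in $A$ and every element below the median is in $R$. Algorithms access the order only through pairwise comparison queries; the same pair may be queried several times (resampling). Query complexity is the total number of comparisons; round complexity is the number of adaptive rounds (within a round all queries are chosen before any answer of that round is seen). Erasure model with parameter $\gamma$: each comparison independently returns the correct answer with probability $\gamma$ and the symbol $\bot$ (erased) with probability $1-\gamma$. $\log^*$ is the iterated logarithm (base 2). $1/\mathrm{poly}(n)$ denotes an inverse polynomial in $n$. Asymptotics are as $n\to\infty$. *)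

theory Defs
  imports
    "HOL-Probability.Probability_Mass_Function"
    "HOL-Combinatorics.Permutations"
    "HOL-Computational_Algebra.Polynomial"
begin

text \<open>
  The elements are \<open>0, \<dots>, n - 1\<close>. The unknown total order is given by a permutation \<open>rk\<close> of
  \<open>{..<n}\<close>: element \<open>i\<close> is below element \<open>j\<close> iff \<open>rk i < rk j\<close>.
\<close>

type_synonym query = "nat \<times> nat"

text \<open>\<open>None\<close> is the erasure symbol; \<open>Some b\<close> says whether the first element is below the second.\<close>

type_synonym answer = "bool option"

definition answer_pmf :: "real \<Rightarrow> (nat \<Rightarrow> nat) \<Rightarrow> query \<Rightarrow> answer pmf" where
  "answer_pmf \<gamma> rk q =
     map_pmf (\<lambda>b. if b then Some (rk (fst q) < rk (snd q)) else None) (bernoulli_pmf \<gamma>)"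

text \<open>
  One round of queries, answered independently of each other. Since the round is a list, the
  same pair may occur in it several times and is then resampled each time.
\<close>

primrec answers_pmf :: "real \<Rightarrow> (nat \<Rightarrow> nat) \<Rightarrow> query list \<Rightarrow> answer list pmf" where
  "answers_pmf \<gamma> rk [] = return_pmf []"
| "answers_pmf \<gamma> rk (q # qs) =
     bind_pmf (answer_pmf \<gamma> rk q) (\<lambda>a. map_pmf ((#) a) (answers_pmf \<gamma> rk qs))"

text \<open>
  A deterministic algorithm either outputs the accepted and the rejected set, or asks a round of
  queries and continues depending on the answers. A randomized algorithm is a
  probability distribution over deterministic ones.
\<close>

datatype alg =
    Output "nat set" "nat set"
  | Round "query list" "answer list \<Rightarrow> alg"

type_synonym rand_alg = "alg pmf"

primrec valid_alg :: "nat \<Rightarrow> alg \<Rightarrow> bool" where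
  "valid_alg n (Output A R) \<longleftrightarrow> A \<union> R = {..<n} \<and> A \<inter> R = {}"
| "valid_alg n (Round qs cont) \<longleftrightarrow>
     (\<forall>(i, j) \<in> set qs. i < n \<and> j < n \<and> i \<noteq> j) \<and>
     (\<forall>as. length as = length qs \<longrightarrow> valid_alg n (cont as))"

record outcome =
  queries :: nat
  rounds :: nat
  accepted :: "nat set"
  rejected :: "nat set"

primrec run :: "real \<Rightarrow> (nat \<Rightarrow> nat) \<Rightarrow> alg \<Rightarrow> outcome pmf" where
  "run \<gamma> rk (Output A R) =
     return_pmf \<lparr>queries = 0, rounds = 0, accepted = A, rejected = R\<rparr>"
| "run \<gamma> rk (Round qs cont) =
     bind_pmf (answers_pmf \<gamma> rk qs) (\<lambda>as.
       map_pmf (\<lambda>res. res\<lparr>queries := length qs + queries res, rounds := Suc (rounds res)\<rparr>)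
         (run \<gamma> rk (cont as)))"

text \<open>
  The joint distribution of the hidden order and the outcome, over the uniformly random order of
  the input, the coins of the algorithm and the erasures.
\<close>

definition joint_pmf :: "real \<Rightarrow> nat \<Rightarrow> rand_alg \<Rightarrow> ((nat \<Rightarrow> nat) \<times> outcome) pmf" where
  "joint_pmf \<gamma> n alg =
     bind_pmf (pmf_of_set {rk. rk permutes {..<n}}) (\<lambda>rk.
     bind_pmf alg (\<lambda>a.
     map_pmf (\<lambda>out. (rk, out)) (run \<gamma> rk a)))"

text \<open>
  The median of the ranks \<open>0, \<dots>, n - 1\<close>. For even \<open>n\<close> it separates the top \<open>n / 2\<close> elements from
  the bottom \<open>n / 2\<close>; for odd \<open>n\<close> it is the rank of the middle element, which may be put on either
  side.
\<close>

definition median_rank :: "nat \<Rightarrow> real" where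
  "median_rank n = (real n - 1) / 2"

definition solves_partition :: "nat \<Rightarrow> (nat \<Rightarrow> nat) \<Rightarrow> outcome \<Rightarrow> bool" where
  "solves_partition n rk out \<longleftrightarrow>
     (\<forall>i<n. (real (rk i) > median_rank n \<longrightarrow> i \<in> accepted out) \<and>
            (real (rk i) < median_rank n \<longrightarrow> i \<in> rejected out))"

definition log_star :: "real \<Rightarrow> nat" where
  "log_star x = (LEAST k. (log 2 ^^ k) x \<le> 1)"

end

theory Submission
  imports Defs "HOL-Probability.Probability" "HOL-Real_Asymp.Real_Asymp"
begin

text \<open>
  Call a comparison resolved once it has been answered. Asking a comparison \<open>\<lceil>t / \<gamma>\<rceil>\<close> times leaves
  it unresolved with probability at most \<open>exp (- t)\<close>; so \<open>n / ln n\<close> comparisons can, with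
  high probability, all be resolved in a single round with \<open>O(n / \<gamma>)\<close> queries.

  One round sorts a random sample of about \<open>n powr 0.45\<close> elements. By Hoeffding's inequality its order
  statistics next to the middle give two pivots on both sides of the median, at rank distance at
  most \<open>n powr 0.8\<close>. Then every element is compared with both pivots. Asking each comparison
  \<open>4 \<rho> / \<gamma>\<close> times leaves, by Chebyshev's inequality, at most a fraction \<open>2 exp (- \<rho>)\<close> of them
  unresolved, so in the next round \<open>\<rho>\<close> may be replaced by \<open>2 ^ \<rho>\<close>; after \<open>log_star n + 1\<close> rounds
  nothing is left. The \<open>O(n powr 0.8)\<close> elements between the pivots are shrunk twice, by comparing
  them with those members of a fresh random sample that lie between the pivots, to
  \<open>O(n powr 0.41)\<close> elements, for which all comparisons fit into one round.
\<close>

subsection \<open>Resampling\<close>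

text \<open>The centre \<open>c\<close> is arbitrary for the sake of the induction: conditioning on
  the first coin shifts it by 0 or 1. At \<open>c = n * p\<close> the value is the variance.\<close>

lemma binomial_second_moment:
  fixes p c :: real
  assumes "p \<in> {0..1}"
  shows "measure_pmf.expectation (binomial_pmf n p) (\<lambda>k. (real k - c)\<^sup>2) =
         real n * p * (1 - p) + (real n * p - c)\<^sup>2"
proof (induction n arbitrary: c)
  case 0
  then show ?case using assms by (simp add: expectation_binomial_pmf' power2_eq_square)
next
  case (Suc n)
  have fin: "finite (set_pmf (binomial_pmf n p))"
    using assms by auto
  have "measure_pmf.expectation (binomial_pmf (Suc n) p) (\<lambda>k. (real k - c)\<^sup>2) =
    measure_pmf.expectation (bernoulli_pmf p) (\<lambda>b.
      measure_pmf.expectation (binomial_pmf n p) (\<lambda>k. (real k - (c - of_bool b))\<^sup>2))"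
    using assms fin unfolding binomial_pmf_Suc[OF assms]
    by (subst pmf_expectation_bind[where A = UNIV])
       (auto simp: UNIV_bool map_pmf_def[symmetric] algebra_simps
             intro!: integral_cong sum.cong)
  also have "\<dots> = real (Suc n) * p * (1 - p) + (real (Suc n) * p - c)\<^sup>2"
    unfolding Suc using assms by (simp add: algebra_simps power2_eq_square)
  finally show ?case .
qed

lemma binomial_mean:
  fixes p :: real
  assumes "p \<in> {0..1}"
  shows "measure_pmf.expectation (binomial_pmf n p) real = real n * p"
proof (induction n)
  case 0
  then show ?case using assms by (simp add: expectation_binomial_pmf')
next
  case (Suc n)
  have fin: "finite (set_pmf (binomial_pmf n p))"
    using assms by auto
  have "measure_pmf.expectation (binomial_pmf (Suc n) p) real =
    measure_pmf.expectation (bernoulli_pmf p) (\<lambda>b.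
      measure_pmf.expectation (binomial_pmf n p) (\<lambda>k. of_bool b + real k))"
    using assms fin unfolding binomial_pmf_Suc[OF assms]
    by (subst pmf_expectation_bind[where A = UNIV])
       (auto simp: UNIV_bool map_pmf_def[symmetric] algebra_simps
             intro!: integral_cong sum.cong)
  also have "\<dots> = real (Suc n) * p"
    using assms Suc by (simp add: algebra_simps)
  finally show ?case .
qed

lemma binomial_Chebyshev:
  assumes p: "p \<in> {0..1}" and a: "a > 0"
  shows "measure_pmf.prob (binomial_pmf n p) {k. real k \<ge> real n * p + a} \<le> real n * p / a\<^sup>2"
proof -
  let ?B = "binomial_pmf n p"
  have mean: "measure_pmf.expectation ?B real = real n * p"
    using p by (simp add: binomial_mean)
  have "measure_pmf.prob ?B {k. real k \<ge> real n * p + a} \<le>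
        measure_pmf.prob ?B {k \<in> space ?B. \<bar>real k - measure_pmf.expectation ?B real\<bar> \<ge> a}"
    unfolding mean by (intro measure_pmf.finite_measure_mono) auto
  also have "\<dots> \<le> measure_pmf.variance ?B real / a\<^sup>2"
    using p a by (intro measure_pmf.Chebyshev_inequality) auto
  also have "measure_pmf.variance ?B real = real n * p * (1 - p)"
    unfolding mean using binomial_second_moment[OF p] by simp
  \<comment> \<open>Without the factor \<open>1 - p\<close> the bound increases with
    \<open>p\<close>, so that \<open>unresolved_tail\<close> can insert an upper bound on the
    erasure probability.\<close>
  also have "\<dots> / a\<^sup>2 \<le> real n * p / a\<^sup>2"
    using p by (intro divide_right_mono mult_right_le_one_le) auto
  finally show ?thesis .
qed

section \<open>Collapsing repeated comparisons into one\<close>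

definition first_answer :: "answer list \<Rightarrow> answer" where
  "first_answer as = (case filter (\<lambda>a. a \<noteq> None) as of [] \<Rightarrow> None | a # _ \<Rightarrow> a)"

definition repeated :: "nat \<Rightarrow> query list \<Rightarrow> query list" where
  "repeated r ws = concat (map (replicate r) ws)"

primrec verdict :: "nat \<Rightarrow> query list \<Rightarrow> answer list \<Rightarrow> answer list" where
  "verdict r [] as = []"
| "verdict r (w # ws) as = first_answer (take r as) # verdict r ws (drop r as)"

lemma length_repeated [simp]: "length (repeated r ws) = r * length ws"
  unfolding repeated_def by (induction ws) auto

lemma set_repeated: "set (repeated r ws) \<subseteq> set ws"
  unfolding repeated_def by (induction ws) auto

lemma answers_pmf_append:
  "answers_pmf \<gamma> rk (us @ ws) =
   bind_pmf (answers_pmf \<gamma> rk us) (\<lambda>as. map_pmf ((@) as) (answers_pmf \<gamma> rk ws))"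
  by (induction us)
     (simp_all add: map_pmf_def bind_assoc_pmf bind_return_pmf bind_return_pmf')

lemma length_answers: "as \<in> set_pmf (answers_pmf \<gamma> rk ws) \<Longrightarrow> length as = length ws"
  by (induction ws arbitrary: as) auto

lemma answers_correct:
  assumes "as \<in> set_pmf (answers_pmf \<gamma> rk ws)" "(q, Some b) \<in> set (zip ws as)"
  shows "b \<longleftrightarrow> rk (fst q) < rk (snd q)"
  using assms
  by (induction ws arbitrary: as) (auto simp: answer_pmf_def split: if_splits)

lemma first_answer_Cons: "first_answer (a # as) = (if a = None then first_answer as else a)"
  by (simp add: first_answer_def)

text \<open>Answers are never wrong, only missing, so a comparison is lost only if all
  \<open>r\<close> copies are erased. In the induction the first copy either answers or leaves the
  matter to the others.\<close>

lemma first_answer_replicate: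
  assumes "0 \<le> \<gamma>" "\<gamma> \<le> 1"
  shows "map_pmf first_answer (answers_pmf \<gamma> rk (replicate r q)) = answer_pmf (1 - (1 - \<gamma>) ^ r) rk q"
proof (induction r)
  case 0
  have "bernoulli_pmf 0 = return_pmf False"
    by (rule pmf_eqI) (auto simp: indicator_def split: bool.splits)
  then show ?case by (simp add: answer_pmf_def first_answer_def)
next
  case (Suc r)
  let ?\<delta> = "1 - (1 - \<gamma>) ^ r"
  let ?t = "\<lambda>b. if b then Some (rk (fst q) < rk (snd q)) else None"
  have d: "0 \<le> (1 - \<gamma>) ^ r" "(1 - \<gamma>) ^ r \<le> 1"
    using assms by (auto intro: power_le_one)
  have "map_pmf first_answer (answers_pmf \<gamma> rk (replicate (Suc r) q)) =
        bind_pmf (answer_pmf \<gamma> rk q) (\<lambda>a. map_pmf (\<lambda>as. first_answer (a # as)) (answers_pmf \<gamma> rk (replicate r q)))"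
    by (simp add: map_bind_pmf pmf.map_comp o_def)
  also have "\<dots> = bind_pmf (answer_pmf \<gamma> rk q) (\<lambda>a. if a = None then answer_pmf ?\<delta> rk q else return_pmf a)"
    unfolding Suc[symmetric]
    by (intro bind_pmf_cong) (auto simp: first_answer_Cons)
  also have "\<dots> = bind_pmf (bernoulli_pmf \<gamma>) (\<lambda>b. if b then return_pmf (?t True) else map_pmf ?t (bernoulli_pmf ?\<delta>))"
    unfolding answer_pmf_def bind_map_pmf by (intro bind_pmf_cong) auto
  also have "\<dots> = map_pmf ?t (bind_pmf (bernoulli_pmf \<gamma>) (\<lambda>b. if b then return_pmf True else bernoulli_pmf ?\<delta>))"
    unfolding map_bind_pmf by (intro bind_pmf_cong) auto
  also have "bind_pmf (bernoulli_pmf \<gamma>) (\<lambda>b. if b then return_pmf True else bernoulli_pmf ?\<delta>) =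
             bernoulli_pmf (1 - (1 - \<gamma>) ^ Suc r)"
  proof (rule pmf_eqI)
    fix b
    have "0 \<le> (1 - \<gamma>) ^ Suc r" "(1 - \<gamma>) ^ Suc r \<le> 1"
      using assms by (auto intro!: power_le_one simp del: power_Suc)
    then show "pmf (bind_pmf (bernoulli_pmf \<gamma>) (\<lambda>b. if b then return_pmf True else bernoulli_pmf ?\<delta>)) b =
        pmf (bernoulli_pmf (1 - (1 - \<gamma>) ^ Suc r)) b"
      using assms d by (cases b) (simp_all add: pmf_bind algebra_simps)
  qed
  finally show ?case by (simp add: answer_pmf_def)
qed

text \<open>Blocks belonging to different comparisons are independent, so
  \<open>first_answer_replicate\<close> applies to each. From here on a round of repeated queries
  counts as a round of single queries with erasure probability
  \<open>(1 - \<gamma>) ^ r\<close>.\<close>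

lemma verdict_repeated:
  assumes "0 \<le> \<gamma>" "\<gamma> \<le> 1"
  shows "map_pmf (verdict r ws) (answers_pmf \<gamma> rk (repeated r ws)) =
         answers_pmf (1 - (1 - \<gamma>) ^ r) rk ws"
proof (induction ws)
  case Nil
  then show ?case by (simp add: repeated_def)
next
  case (Cons w ws)
  have eq: "repeated r (w # ws) = replicate r w @ repeated r ws"
    by (simp add: repeated_def)
  have "map_pmf (verdict r (w # ws)) (answers_pmf \<gamma> rk (repeated r (w # ws))) =
    bind_pmf (answers_pmf \<gamma> rk (replicate r w)) (\<lambda>as. map_pmf ((#) (first_answer as))
       (map_pmf (verdict r ws) (answers_pmf \<gamma> rk (repeated r ws))))"
    unfolding eq answers_pmf_append map_bind_pmf pmf.map_comp
    by (intro bind_pmf_cong refl map_pmf_cong) (auto dest: length_answers)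
  also have "\<dots> = answers_pmf (1 - (1 - \<gamma>) ^ r) rk (w # ws)"
    unfolding Cons by (simp add: first_answer_replicate[OF assms, symmetric] bind_map_pmf)
  finally show ?case .
qed

text \<open>A list with multiplicities: a comparison occurring twice in \<open>ws\<close> can be
  unresolved twice, which makes the length exactly binomial.\<close>

definition unresolved :: "query list \<Rightarrow> answer list \<Rightarrow> query list" where
  "unresolved ws as = map fst (filter (\<lambda>(q, a). a = None) (zip ws as))"

definition yes :: "query list \<Rightarrow> answer list \<Rightarrow> query set" where
  "yes ws as = {q. (q, Some True) \<in> set (zip ws as)}"

definition below :: "(nat \<Rightarrow> nat) \<Rightarrow> query set \<Rightarrow> query set" where
  "below rk Q = {q \<in> Q. rk (fst q) < rk (snd q)}"

lemma set_unresolved: "set (unresolved ws as) \<subseteq> set ws"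
  unfolding unresolved_def by (auto dest: set_zip_leftD)

text \<open>Correctness of the answers makes this exact. It justifies \<open>resolve\<close>, which
  adds the \<open>yes\<close> of each round to whatever the later rounds find.\<close>

lemma yes_unresolved:
  assumes "as \<in> set_pmf (answers_pmf \<gamma> rk ws)"
  shows "yes ws as \<union> below rk (set (unresolved ws as)) = below rk (set ws)"
proof (intro equalityI subsetI)
  fix q assume "q \<in> yes ws as \<union> below rk (set (unresolved ws as))"
  then show "q \<in> below rk (set ws)"
    using answers_correct[OF assms, of q True] set_unresolved[of ws as]
    by (auto simp: yes_def below_def dest: set_zip_leftD)
next
  fix q assume q: "q \<in> below rk (set ws)"
  then obtain i where i: "i < length ws" "ws ! i = q"
    by (auto simp: below_def in_set_conv_nth)
  then have z: "(q, as ! i) \<in> set (zip ws as)"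
    using length_answers[OF assms] by (auto simp: set_zip)
  show "q \<in> yes ws as \<union> below rk (set (unresolved ws as))"
  proof (cases "as ! i")
    case None
    then show ?thesis using z q by (force simp: unresolved_def below_def)
  next
    case (Some b)
    then show ?thesis using z q answers_correct[OF assms, of q b]
      by (auto simp: yes_def below_def)
  qed
qed

lemma length_unresolved_binomial:
  assumes "0 \<le> \<delta>" "\<delta> \<le> 1"
  shows "map_pmf (\<lambda>as. length (unresolved ws as)) (answers_pmf \<delta> rk ws) =
         binomial_pmf (length ws) (1 - \<delta>)"
proof (induction ws)
  case Nil
  have "binomial_pmf 0 (1 - \<delta>) = return_pmf 0"
    using assms by (intro pmf_eqI) (auto simp: indicator_def)
  then show ?case by (simp add: unresolved_def)
next
  case (Cons w ws)
  have flip: "bernoulli_pmf (1 - \<delta>) = map_pmf Not (bernoulli_pmf \<delta>)"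
  proof (rule pmf_eqI)
    fix b
    show "pmf (bernoulli_pmf (1 - \<delta>)) b = pmf (map_pmf Not (bernoulli_pmf \<delta>)) b"
      using pmf_map_inj'[of Not "bernoulli_pmf \<delta>" "\<not> b"] assms
      by (cases b) (auto simp: inj_def)
  qed
  have "map_pmf (\<lambda>as. length (unresolved (w # ws) as)) (answers_pmf \<delta> rk (w # ws)) =
    bind_pmf (bernoulli_pmf \<delta>) (\<lambda>b. map_pmf (\<lambda>k. of_bool (\<not> b) + k)
      (map_pmf (\<lambda>as. length (unresolved ws as)) (answers_pmf \<delta> rk ws)))"
    by (simp add: answer_pmf_def map_bind_pmf bind_map_pmf pmf.map_comp o_def unresolved_def,
        intro bind_pmf_cong refl map_pmf_cong) (auto)
  also have "\<dots> = binomial_pmf (length (w # ws)) (1 - \<delta>)"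
    using assms unfolding Cons
    by (simp add: binomial_pmf_Suc flip bind_map_pmf map_pmf_def[symmetric] of_bool_def)
  finally show ?case .
qed

subsection \<open>Rounds of comparisons\<close>

lemma prob_bind_pmf:
  "measure_pmf.prob (bind_pmf M f) A = measure_pmf.expectation M (\<lambda>x. measure_pmf.prob (f x) A)"
proof -
  have "ennreal (measure_pmf.prob (bind_pmf M f) A) = (\<integral>\<^sup>+x. ennreal (measure_pmf.prob (f x) A) \<partial>M)"
    by (simp add: measure_pmf.emeasure_eq_measure[symmetric] emeasure_bind_pmf)
  also have "\<dots> = ennreal (measure_pmf.expectation M (\<lambda>x. measure_pmf.prob (f x) A))"
    by (intro nn_integral_eq_integral measure_pmf.integrable_const_bound[where B = 1]) auto
  finally show ?thesis by (simp add: integral_nonneg_AE)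
qed

text \<open>A union bound for two consecutive experiments. Pointwise, \<open>1 - E\<close> minus the
  indicator of a bad outcome is below the inner probability; on a bad outcome it is
  \<open>- E\<close>, which is where \<open>E \<ge> 0\<close> enters.\<close>

lemma prob_bind_pmf_ge:
  assumes bad: "measure_pmf.prob M {x. \<not> good x} \<le> \<epsilon>" and "E \<ge> 0"
    and step: "\<And>x. x \<in> set_pmf M \<Longrightarrow> good x \<Longrightarrow> measure_pmf.prob (f x) A \<ge> 1 - E"
  shows "measure_pmf.prob (bind_pmf M f) A \<ge> 1 - (E + \<epsilon>)"
proof -
  have "1 - (E + \<epsilon>) \<le> measure_pmf.expectation M (\<lambda>x. (1 - E) - indicator {x. \<not> good x} x)"
    using bad by (subst Bochner_Integration.integral_diff)
      (auto intro!: measure_pmf.integrable_const_bound[where B = 1])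
  also have "\<dots> \<le> measure_pmf.expectation M (\<lambda>x. measure_pmf.prob (f x) A)"
  proof (rule integral_mono_AE)
    show "AE x in M. (1 - E) - indicator {x. \<not> good x} x \<le> measure_pmf.prob (f x) A"
    proof (rule AE_pmfI)
      fix x assume "x \<in> set_pmf M"
      then show "(1 - E) - indicator {x. \<not> good x} x \<le> measure_pmf.prob (f x) A"
        using step[of x] \<open>E \<ge> 0\<close> by (cases "good x") (auto intro: order_trans[OF _ measure_nonneg])
    qed
  qed (auto intro!: measure_pmf.integrable_const_bound[where B = 1] Bochner_Integration.integrable_diff)
  finally show ?thesis by (simp add: prob_bind_pmf)
qed

text \<open>The order \<open>rk\<close> is fixed and the algorithm deterministic, so only the
  erasures are random here. The bounds hold for every order; averaging over orders is left to the
  very end.\<close>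

definition success :: "real \<Rightarrow> nat \<Rightarrow> (nat \<Rightarrow> nat) \<Rightarrow> nat \<Rightarrow> real \<Rightarrow> real \<Rightarrow> alg \<Rightarrow> bool" where
  "success \<gamma> n rk T C E a \<longleftrightarrow>
     measure_pmf.prob (run \<gamma> rk a)
       {out. rounds out \<le> T \<and> real (queries out) \<le> C \<and> solves_partition n rk out} \<ge> 1 - E"

lemma success_mono:
  assumes "success \<gamma> n rk T C E a" "T \<le> T'" "C \<le> C'" "E \<le> E'"
  shows "success \<gamma> n rk T' C' E' a"
proof -
  have "1 - E' \<le> 1 - E" using assms by simp
  also have "\<dots> \<le> measure_pmf.prob (run \<gamma> rk a)
       {out. rounds out \<le> T \<and> real (queries out) \<le> C \<and> solves_partition n rk out}"
    using assms by (simp add: success_def)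
  also have "\<dots> \<le> measure_pmf.prob (run \<gamma> rk a)
       {out. rounds out \<le> T' \<and> real (queries out) \<le> C' \<and> solves_partition n rk out}"
    using assms by (intro measure_pmf.finite_measure_mono) auto
  finally show ?thesis by (simp add: success_def)
qed

text \<open>Passing from \<open>repeated r ws\<close> to \<open>ws\<close> by
  \<open>verdict_repeated\<close> lets \<open>good\<close> speak about collapsed answers; the
  budgets of the round and of its continuation then add up.\<close>

lemma success_Round:
  assumes \<gamma>: "0 \<le> \<gamma>" "\<gamma> \<le> 1" and "E \<ge> 0"
    and bad: "measure_pmf.prob (answers_pmf (1 - (1 - \<gamma>) ^ r) rk ws) {as. \<not> good as} \<le> \<epsilon>"
    and step: "\<And>as. as \<in> set_pmf (answers_pmf (1 - (1 - \<gamma>) ^ r) rk ws) \<Longrightarrow> good as \<Longrightarrow>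
                 success \<gamma> n rk T C E (\<kappa> as)"
  shows "success \<gamma> n rk (Suc T) (real (r * length ws) + C) (E + \<epsilon>)
           (Round (repeated r ws) (\<lambda>as. \<kappa> (verdict r ws as)))"
proof -
  define L where "L = r * length ws"
  let ?X = "{out. rounds out \<le> Suc T \<and> real (queries out) \<le> real L + C \<and> solves_partition n rk out}"
  let ?g = "\<lambda>res::outcome. res\<lparr>queries := L + queries res, rounds := Suc (rounds res)\<rparr>"
  have "run \<gamma> rk (Round (repeated r ws) (\<lambda>as. \<kappa> (verdict r ws as))) =
      bind_pmf (answers_pmf \<gamma> rk (repeated r ws)) (\<lambda>as. map_pmf ?g (run \<gamma> rk (\<kappa> (verdict r ws as))))"
    by (simp add: L_def)
  also have "\<dots> = bind_pmf (answers_pmf (1 - (1 - \<gamma>) ^ r) rk ws) (\<lambda>as. map_pmf ?g (run \<gamma> rk (\<kappa> as)))"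
    by (subst verdict_repeated[OF \<gamma>, symmetric]) (simp add: bind_map_pmf)
  finally have eq: "run \<gamma> rk (Round (repeated r ws) (\<lambda>as. \<kappa> (verdict r ws as))) = \<dots>" .
  have "?g -` ?X = {out. rounds out \<le> T \<and> real (queries out) \<le> C \<and> solves_partition n rk out}"
    by (auto simp: solves_partition_def)
  then have "measure_pmf.prob (bind_pmf (answers_pmf (1 - (1 - \<gamma>) ^ r) rk ws)
      (\<lambda>as. map_pmf ?g (run \<gamma> rk (\<kappa> as)))) ?X \<ge> 1 - (E + \<epsilon>)"
    using step \<open>E \<ge> 0\<close> bad unfolding success_def
    by (intro prob_bind_pmf_ge[where good = good]) auto
  then show ?thesis
    unfolding success_def eq by (simp add: L_def)
qed

section \<open>Schedules that resolve a list of comparisons over several rounds\<close>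

primrec resolve :: "nat list \<Rightarrow> query list \<Rightarrow> (query set \<Rightarrow> alg) \<Rightarrow> alg" where
  "resolve [] ws \<kappa> = \<kappa> {}"
| "resolve (r # rs) ws \<kappa> =
     Round (repeated r ws) (\<lambda>as.
       resolve rs (unresolved ws (verdict r ws as)) (\<lambda>Y. \<kappa> (yes ws (verdict r ws as) \<union> Y)))"

lemma valid_resolve:
  assumes "\<And>Y. valid_alg n (\<kappa> Y)" "\<forall>(i, j) \<in> set ws. i < n \<and> j < n \<and> i \<noteq> j"
  shows "valid_alg n (resolve rs ws \<kappa>)"
  using assms
proof (induction rs arbitrary: ws \<kappa>)
  case (Cons r rs)
  have "\<forall>(i, j) \<in> set (repeated r ws). i < n \<and> j < n \<and> i \<noteq> j"
    using Cons.prems(2) set_repeated[of r ws] by blast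
  moreover have "valid_alg n (resolve rs (unresolved ws as) (\<lambda>Y. \<kappa> (yes ws as \<union> Y)))" for as
    using Cons.prems set_unresolved[of ws as] by (intro Cons.IH) blast+
  ultimately show ?case by simp
qed simp

text \<open>A contract quantified over all continuations, which only have to succeed on the exact
  set \<open>below rk (set ws)\<close>. At the end of a schedule \<open>resolve\<close> adds nothing
  for comparisons still open; the resulting error is charged to \<open>\<epsilon>\<close>.\<close>

definition resolves ::
  "real \<Rightarrow> (nat \<Rightarrow> nat) \<Rightarrow> nat list \<Rightarrow> query list \<Rightarrow> real \<Rightarrow> real \<Rightarrow> bool" where
  "resolves \<gamma> rk rs ws c \<epsilon> \<longleftrightarrow>
     (\<forall>n T C E \<kappa>. E \<ge> 0 \<longrightarrow> success \<gamma> n rk T C E (\<kappa> (below rk (set ws))) \<longrightarrow>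
        success \<gamma> n rk (length rs + T) (c + C) (\<epsilon> + E) (resolve rs ws \<kappa>))"

lemma resolves_Nil: "resolves \<gamma> rk [] [] 0 0"
  by (simp add: resolves_def below_def)

text \<open>Only the number of open comparisons is controlled, so the remaining schedule has to work
  for every list of at most \<open>u\<close> of them.\<close>

lemma resolves_Cons:
  assumes \<gamma>: "0 \<le> \<gamma>" "\<gamma> \<le> 1" and \<epsilon>: "\<epsilon>' \<ge> 0"
    and bad: "measure_pmf.prob (answers_pmf (1 - (1 - \<gamma>) ^ r) rk ws)
                {as. \<not> real (length (unresolved ws as)) \<le> u} \<le> \<epsilon>"
    and step: "\<And>ws'. real (length ws') \<le> u \<Longrightarrow> resolves \<gamma> rk rs ws' c \<epsilon>'"
  shows "resolves \<gamma> rk (r # rs) ws (real (r * length ws) + c) (\<epsilon> + \<epsilon>')"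
  unfolding resolves_def
proof (intro allI impI)
  fix n T C E \<kappa>
  assume "(0::real) \<le> E" and s: "success \<gamma> n rk T C E (\<kappa> (below rk (set ws)))"
  define \<kappa>' where "\<kappa>' = (\<lambda>as. resolve rs (unresolved ws as) (\<lambda>Y. \<kappa> (yes ws as \<union> Y)))"
  have "success \<gamma> n rk (Suc (length rs + T)) (real (r * length ws) + (c + C)) ((\<epsilon>' + E) + \<epsilon>)
     (Round (repeated r ws) (\<lambda>as. \<kappa>' (verdict r ws as)))"
  proof (rule success_Round[OF \<gamma> _ bad])
    fix as assume as: "as \<in> set_pmf (answers_pmf (1 - (1 - \<gamma>) ^ r) rk ws)"
      "real (length (unresolved ws as)) \<le> u"
    show "success \<gamma> n rk (length rs + T) (c + C) (\<epsilon>' + E) (\<kappa>' as)"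
      using step[OF as(2)] \<open>E \<ge> 0\<close> s yes_unresolved[OF as(1)]
      unfolding resolves_def \<kappa>'_def by simp
  qed (use \<epsilon> \<open>E \<ge> 0\<close> in auto)
  then show "success \<gamma> n rk (length (r # rs) + T) (real (r * length ws) + c + C) (\<epsilon> + \<epsilon>' + E)
      (resolve (r # rs) ws \<kappa>)"
    by (simp add: \<kappa>'_def add_ac)
qed

lemma resolves_mono:
  assumes "resolves \<gamma> rk rs ws c \<epsilon>" "c \<le> c'" "\<epsilon> \<le> \<epsilon>'"
  shows "resolves \<gamma> rk rs ws c' \<epsilon>'"
  using assms unfolding resolves_def by (meson add_right_mono order_refl success_mono)

section \<open>Numbers of repetitions and the tail of the unresolved comparisons\<close>

definition reps :: "real \<Rightarrow> real \<Rightarrow> nat" where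
  "reps \<gamma> t = nat \<lceil>t / \<gamma>\<rceil>"

text \<open>Since \<open>t / \<gamma> \<ge> 1\<close>, rounding up costs at most a factor 2.\<close>

lemma reps_le:
  assumes "0 < \<gamma>" "\<gamma> \<le> 1" "t \<ge> 1"
  shows "real (reps \<gamma> t) \<le> 2 * t / \<gamma>"
proof -
  have "t / \<gamma> \<ge> 1"
    using assms by (simp add: field_simps)
  then show ?thesis unfolding reps_def by linarith
qed

lemma erasure_reps:
  assumes "0 < \<gamma>" "\<gamma> \<le> 1"
  shows "(1 - \<gamma>) ^ reps \<gamma> t \<le> exp (- t)"
proof -
  have "(1 - \<gamma>) ^ reps \<gamma> t \<le> exp (- \<gamma>) ^ reps \<gamma> t"
    using assms exp_ge_add_one_self[of "- \<gamma>"] by (intro power_mono) auto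
  also have "\<dots> = exp (- (\<gamma> * real (reps \<gamma> t)))"
    by (simp add: exp_of_nat_mult[symmetric] algebra_simps)
  also have "t / \<gamma> \<le> real (reps \<gamma> t)"
    unfolding reps_def by linarith
  then have "t \<le> \<gamma> * real (reps \<gamma> t)"
    using assms by (simp add: field_simps)
  then have "exp (- (\<gamma> * real (reps \<gamma> t))) \<le> exp (- t)"
    by simp
  finally show ?thesis .
qed

lemma unresolved_tail:
  assumes \<gamma>: "0 < \<gamma>" "\<gamma> \<le> 1" and a: "a > 0"
  shows "measure_pmf.prob (answers_pmf (1 - (1 - \<gamma>) ^ reps \<gamma> t) rk ws)
           {as. real (length (unresolved ws as)) \<ge> real (length ws) * exp (- t) + a}
         \<le> real (length ws) * exp (- t) / a\<^sup>2"
proof -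
  define w where "w = (1 - \<gamma>) ^ reps \<gamma> t"
  have w: "0 \<le> w" "w \<le> 1" "w \<le> exp (- t)"
    using assms erasure_reps[OF \<gamma>, of t] by (auto simp: w_def intro: power_le_one)
  have "measure_pmf.prob (answers_pmf (1 - w) rk ws)
           {as. real (length (unresolved ws as)) \<ge> real (length ws) * exp (- t) + a} =
        measure_pmf.prob (map_pmf (\<lambda>as. length (unresolved ws as)) (answers_pmf (1 - w) rk ws))
           {k. real k \<ge> real (length ws) * exp (- t) + a}"
    by (simp add: vimage_def)
  also have "\<dots> = measure_pmf.prob (binomial_pmf (length ws) w)
           {k. real k \<ge> real (length ws) * exp (- t) + a}"
    using w by (subst length_unresolved_binomial) auto
  also have "\<dots> \<le> measure_pmf.prob (binomial_pmf (length ws) w) {k. real k \<ge> real (length ws) * w + a}"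
  proof (intro measure_pmf.finite_measure_mono)
    have "real (length ws) * w \<le> real (length ws) * exp (- t)"
      using w by (intro mult_left_mono) auto
    then show "{k. real k \<ge> real (length ws) * exp (- t) + a} \<subseteq> {k. real k \<ge> real (length ws) * w + a}"
      by auto
  qed auto
  also have "\<dots> \<le> real (length ws) * w / a\<^sup>2"
    using w a by (intro binomial_Chebyshev) auto
  also have "\<dots> \<le> real (length ws) * exp (- t) / a\<^sup>2"
    using w by (intro divide_right_mono mult_left_mono) auto
  finally show ?thesis by (simp add: w_def)
qed

lemma resolves_single:
  assumes \<gamma>: "0 < \<gamma>" "\<gamma> \<le> 1" and t: "t \<ge> 1" "real (length ws) * exp (- t) \<le> 1 / 2"
  shows "resolves \<gamma> rk [reps \<gamma> t] ws (2 * t / \<gamma> * real (length ws)) (4 * (real (length ws) * exp (- t)))"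
proof (rule resolves_mono)
  show "resolves \<gamma> rk [reps \<gamma> t] ws (real (reps \<gamma> t * length ws) + 0) (4 * (real (length ws) * exp (- t)) + 0)"
  proof (rule resolves_Cons)
    \<comment> \<open>A positive count is at least 1 and so exceeds the bound on the mean, which is
      at most 1/2, by at least 1/2. Chebyshev with deviation 1/2 gives the factor 4.\<close>
    have "measure_pmf.prob (answers_pmf (1 - (1 - \<gamma>) ^ reps \<gamma> t) rk ws)
         {as. \<not> real (length (unresolved ws as)) \<le> 0} \<le>
       measure_pmf.prob (answers_pmf (1 - (1 - \<gamma>) ^ reps \<gamma> t) rk ws)
         {as. real (length (unresolved ws as)) \<ge> real (length ws) * exp (- t) + 1 / 2}"
    proof (intro measure_pmf.finite_measure_mono subsetI)
      fix as assume "as \<in> {as. \<not> real (length (unresolved ws as)) \<le> 0}"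
      then have "length (unresolved ws as) \<ge> 1" by (cases "unresolved ws as") auto
      then show "as \<in> {as. real (length (unresolved ws as)) \<ge> real (length ws) * exp (- t) + 1 / 2}"
        using t by simp
    qed auto
    also have "\<dots> \<le> 4 * (real (length ws) * exp (- t))"
      using unresolved_tail[OF \<gamma>, of "1 / 2" t rk ws] by (simp add: power2_eq_square)
    finally show "measure_pmf.prob (answers_pmf (1 - (1 - \<gamma>) ^ reps \<gamma> t) rk ws)
         {as. \<not> real (length (unresolved ws as)) \<le> 0} \<le> 4 * (real (length ws) * exp (- t))" .
  next
    fix ws' :: "query list" assume "real (length ws') \<le> 0"
    then show "resolves \<gamma> rk [] ws' 0 0" using resolves_Nil by simp
  qed (use \<gamma> in auto)
  show "real (reps \<gamma> t * length ws) + 0 \<le> 2 * t / \<gamma> * real (length ws)"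
    using mult_right_mono[OF reps_le[OF \<gamma> t(1)], of "real (length ws)"] by simp
qed simp

subsection \<open>The iterated logarithm\<close>

primrec tower :: "nat \<Rightarrow> nat" where
  "tower 0 = 1"
| "tower (Suc k) = 2 ^ tower k"

lemma tower_ge: "k + 1 \<le> tower k"
proof (induction k)
  case (Suc k)
  have "Suc k + 1 \<le> Suc (tower k)" using Suc by simp
  also have "\<dots> \<le> 2 ^ tower k" using less_exp[of "tower k"] by (simp only: Suc_le_eq)
  finally show ?case by simp
qed simp

text \<open>\<open>log_star\<close> is a \<open>LEAST\<close>, so some iterate at most 1 has to
  exist. Each logarithm removes one level of the tower.\<close>

lemma log_iterate_le_1:
  assumes "x \<le> real (tower k)"
  shows "\<exists>j. (log 2 ^^ j) x \<le> 1"
  using assms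
proof (induction k arbitrary: x)
  case 0
  then show ?case by (intro exI[of _ 0]) simp
next
  case (Suc k)
  show ?case
  proof (cases "x \<le> 1")
    case True
    then show ?thesis by (intro exI[of _ 0]) simp
  next
    case False
    then have "log 2 x \<le> real (tower k)"
      using Suc.prems by (simp add: log_le_iff powr_realpow)
    from Suc.IH[OF this] obtain j where "(log 2 ^^ j) (log 2 x) \<le> 1" by blast
    then show ?thesis by (intro exI[of _ "Suc j"]) (simp add: funpow_swap1)
  qed
qed

lemma le_tower_if_log_iterate_le_1:
  "(log 2 ^^ k) x \<le> 1 \<Longrightarrow> x \<le> real (tower k)"
proof (induction k arbitrary: x)
  case (Suc k)
  then have le: "log 2 x \<le> real (tower k)" by (simp add: funpow_swap1)
  show ?case
  proof (cases "x > 0")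
    case True
    then show ?thesis using le by (simp add: log_le_iff powr_realpow)
  next
    \<comment> \<open>Outside the domain of the logarithm its value says nothing, but the bound is
      trivial.\<close>
    case False
    then show ?thesis by (meson of_nat_0_le_iff order_trans not_less)
  qed
qed simp

lemma le_tower_log_star: "n \<le> tower (log_star (real n))"
proof -
  have "real n \<le> real (tower n)"
    using tower_ge[of n] by simp
  from log_iterate_le_1[OF this] have "(log 2 ^^ log_star (real n)) (real n) \<le> 1"
    unfolding log_star_def by (rule LeastI_ex)
  from le_tower_if_log_iterate_le_1[OF this] show ?thesis by simp
qed

text \<open>Uses \<open>exp 1 \<ge> 5 / 2\<close>. The constant matters because
  \<open>2 * (2 / 5) < 1\<close>: open comparisons die out faster than their repetitions
  grow.\<close>

lemma exp_minus_nat_le: "exp (- real k) \<le> (2 / 5) ^ k"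
proof -
  have "5 / 2 \<le> exp (1 :: real)"
    using exp_lower_Taylor_quadratic[of 1] by simp
  then have "exp (- 1 :: real) \<le> 2 / 5"
    by (simp add: exp_minus field_simps)
  then have "exp (- 1 :: real) ^ k \<le> (2 / 5) ^ k"
    by (intro power_mono) auto
  then show ?thesis by (simp add: exp_of_nat_mult[symmetric])
qed

text \<open>
  With \<open>\<rho> = tower i\<close>, round \<open>i\<close> leaves at most \<open>2 m exp (- \<rho>)\<close> queries unanswered, and the next
  round repeats each of them about \<open>4 * 2 ^ \<rho> / \<gamma>\<close> times: the cost of the rounds decreases
  geometrically since \<open>2 < exp 1\<close>.
\<close>

lemma resolves_tower_from:
  fixes m :: real
  assumes \<gamma>: "0 < \<gamma>" "\<gamma> \<le> 1" and m: "m > 0" "2 * m < real (tower (Suc K))"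
    and k: "k \<le> Suc K" and ws: "real (length ws) * real (tower k) \<le> 2 * m * (4 / 5) ^ k"
  shows "resolves \<gamma> rk (map (\<lambda>i. reps \<gamma> (4 * real (tower i))) [k..<Suc K]) ws
           (80 * m * (4 / 5) ^ k / \<gamma>) ((1 / 2) ^ k / m)"
  using k ws
\<comment> \<open>Downward induction from \<open>Suc K\<close>, so that the budget at
  \<open>k\<close> pays for all rounds from \<open>k\<close> on.\<close>
proof (induction arbitrary: ws rule: inc_induct)
  \<comment> \<open>With \<open>tower (Suc K)\<close> above \<open>2 * m\<close> the invariant
    leaves room for fewer than one comparison, that is for none.\<close>
  case base
  have "(4 / 5 :: real) ^ Suc K \<le> 1" by (rule power_le_one) auto
  then have "2 * m * (4 / 5) ^ Suc K \<le> 2 * m" using m by (simp add: mult_le_cancel_left1)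
  with base have "real (length ws) * real (tower (Suc K)) < real (tower (Suc K))"
    using m by linarith
  then have "ws = []" by (cases ws) (auto simp: mult_less_cancel_right1)
  then have "resolves \<gamma> rk [] ws 0 0" using resolves_Nil by simp
  then show ?case
    using m \<gamma> by (auto elim!: resolves_mono)
next
  case (step k)
  define \<rho> where "\<rho> = tower k"
  have \<rho>: "k + 1 \<le> \<rho>" "1 \<le> \<rho>" using tower_ge[of k] by (auto simp: \<rho>_def)
  have len: "real (length ws) \<le> 2 * m"
  proof -
    have "real (length ws) * 1 \<le> real (length ws) * real \<rho>"
      using \<rho> by (intro mult_left_mono) auto
    also have "\<dots> \<le> 2 * m * (4 / 5) ^ k" using step.prems by (simp add: \<rho>_def)
    also have "\<dots> \<le> 2 * m * 1" using m by (intro mult_left_mono power_le_one) auto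
    finally show ?thesis by simp
  qed
  have e1: "exp (- real \<rho>) \<le> 2 / 5"
    using exp_minus_nat_le[of \<rho>] power_decreasing[of 1 \<rho> "2 / 5 :: real"] \<rho> by simp
  define e where "e = exp (- real \<rho>)"
  have e: "0 < e" "e \<le> 2 / 5" using e1 by (auto simp: e_def)
  have e4: "exp (- (4 * real \<rho>)) = e ^ 4" 
    by (simp add: e_def exp_of_nat_mult[symmetric])
  have e3: "e ^ 3 \<le> 1 / 2"
    using power_mono[of e "2 / 5" 3] e by (simp add: power3_eq_cube)
  \<comment> \<open>The argument \<open>4 * \<rho>\<close> brings the mean down to
    \<open>2 * m * e ^ 4 \<le> m * e\<close>; Chebyshev with deviation \<open>m * e\<close> bounds
    the open comparisons by \<open>2 * m * e\<close>. The fourth power survives the division by the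
    squared deviation.\<close>
  have "resolves \<gamma> rk (reps \<gamma> (4 * real \<rho>) # map (\<lambda>i. reps \<gamma> (4 * real (tower i))) [Suc k..<Suc K]) ws
      (real (reps \<gamma> (4 * real \<rho>) * length ws) + 80 * m * (4 / 5) ^ Suc k / \<gamma>)
      (2 * m * e ^ 4 / (m * e)\<^sup>2 + (1 / 2) ^ Suc k / m)"
  proof (rule resolves_Cons)
    show "measure_pmf.prob (answers_pmf (1 - (1 - \<gamma>) ^ reps \<gamma> (4 * real \<rho>)) rk ws)
       {as. \<not> real (length (unresolved ws as)) \<le> 2 * m * e} \<le> 2 * m * e ^ 4 / (m * e)\<^sup>2"
      (is "measure_pmf.prob ?P _ \<le> _")
    proof -
      have "real (length ws) * e ^ 4 \<le> 2 * m * e ^ 4"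
        using len e by (intro mult_right_mono) auto
      also have "\<dots> = 2 * m * e * e ^ 3" by (simp add: power_eq_if)
      also have "\<dots> \<le> 2 * m * e * (1 / 2)"
        using e e3 m by (intro mult_left_mono) auto
      finally have le: "real (length ws) * e ^ 4 \<le> m * e" by simp
      have "measure_pmf.prob ?P {as. \<not> real (length (unresolved ws as)) \<le> 2 * m * e} \<le>
            measure_pmf.prob ?P {as. real (length (unresolved ws as)) \<ge> real (length ws) * exp (- (4 * real \<rho>)) + m * e}"
        using le unfolding e4 by (intro measure_pmf.finite_measure_mono) auto
      also have "\<dots> \<le> real (length ws) * exp (- (4 * real \<rho>)) / (m * e)\<^sup>2"
        using m e by (intro unresolved_tail \<gamma>) auto
      also have "\<dots> \<le> 2 * m * e ^ 4 / (m * e)\<^sup>2"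
        unfolding e4 using len e by (intro divide_right_mono mult_right_mono) auto
      finally show ?thesis .
    qed
  next
    fix ws' :: "query list" assume ws': "real (length ws') \<le> 2 * m * e"
    \<comment> \<open>The next tower level is \<open>2 ^ \<rho>\<close>; as
      \<open>\<rho> \<ge> k + 1\<close>, the bound \<open>(4 / 5) ^ \<rho>\<close> restores the
      invariant at \<open>Suc k\<close>.\<close>
    have "e * 2 ^ \<rho> \<le> (2 / 5) ^ \<rho> * 2 ^ \<rho>"
      unfolding e_def using exp_minus_nat_le[of \<rho>] by (intro mult_right_mono) auto
    also have "\<dots> = (4 / 5 :: real) ^ \<rho>" by (simp flip: power_mult_distrib)
    also have "\<dots> \<le> (4 / 5) ^ Suc k" using \<rho> by (intro power_decreasing) auto
    finally have "2 * m * (e * 2 ^ \<rho>) \<le> 2 * m * (4 / 5) ^ Suc k"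
      using m by (intro mult_left_mono) auto
    then have "2 * m * e * 2 ^ \<rho> \<le> 2 * m * (4 / 5) ^ Suc k"
      unfolding mult.assoc .
    moreover have "real (length ws') * real (tower (Suc k)) \<le> 2 * m * e * 2 ^ \<rho>"
      using mult_right_mono[OF ws', of "2 ^ \<rho>"] by (simp add: \<rho>_def)
    ultimately have "real (length ws') * real (tower (Suc k)) \<le> 2 * m * (4 / 5) ^ Suc k"
      by (rule order_trans[rotated])
    then show "resolves \<gamma> rk (map (\<lambda>i. reps \<gamma> (4 * real (tower i))) [Suc k..<Suc K]) ws'
        (80 * m * (4 / 5) ^ Suc k / \<gamma>) ((1 / 2) ^ Suc k / m)"
      by (rule step.IH)
  qed (use \<gamma> m in auto)
  then show ?case
  proof (subst upt_conv_Cons, goal_cases)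
    case 2
    have cost: "real (reps \<gamma> (4 * real \<rho>) * length ws) \<le> 16 * m * (4 / 5) ^ k / \<gamma>"
    proof -
      have "real (reps \<gamma> (4 * real \<rho>)) \<le> 2 * (4 * real \<rho>) / \<gamma>"
        using \<rho> \<gamma> by (intro reps_le) auto
      then have "real (reps \<gamma> (4 * real \<rho>) * length ws) \<le> 2 * (4 * real \<rho>) / \<gamma> * real (length ws)"
        by (simp add: mult_right_mono del: times_divide_eq_left)
      also have "\<dots> = 8 / \<gamma> * (real (length ws) * real (tower k))" by (simp add: \<rho>_def)
      also have "\<dots> \<le> 8 / \<gamma> * (2 * m * (4 / 5) ^ k)"
        using step.prems \<gamma> by (intro mult_left_mono) auto
      finally show ?thesis by simp
    qed
    \<comment> \<open>The failure term of this round is \<open>2 * e * e / m\<close>. This round and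
      all later ones each receive half of the allowance \<open>(1 / 2) ^ k / m\<close>.\<close>
    have "e * (2 * e) \<le> (2 / 5) ^ \<rho> * 1"
      unfolding e_def using exp_minus_nat_le[of \<rho>] e by (intro mult_mono) (auto simp: e_def)
    also have "\<dots> \<le> (1 / 2) ^ \<rho>" by (simp add: power_mono)
    also have "\<dots> \<le> (1 / 2) ^ Suc k" using \<rho> by (intro power_decreasing) auto
    finally have "2 * m * e ^ 4 / (m * e)\<^sup>2 \<le> (1 / 2) ^ Suc k / m"
      using m e by (simp add: field_simps power2_eq_square power4_eq_xxxx)
    then have fail: "2 * m * e ^ 4 / (m * e)\<^sup>2 + (1 / 2) ^ Suc k / m \<le> (1 / 2) ^ k / m"
      by simp
    \<comment> \<open>The constant 80 solves \<open>16 + 80 * (4 / 5) = 80\<close>: it is the sum of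
      the geometric series of the costs.\<close>
    have eq: "16 * m * (4 / 5) ^ k / \<gamma> + 80 * m * (4 / 5) ^ Suc k / \<gamma> = 80 * m * (4 / 5) ^ k / \<gamma>"
      using \<gamma> by (simp add: field_simps)
    have "real (reps \<gamma> (4 * real \<rho>) * length ws) + 80 * m * (4 / 5) ^ Suc k / \<gamma>
        \<le> 80 * m * (4 / 5) ^ k / \<gamma>"
      using add_right_mono[OF cost, of "80 * m * (4 / 5) ^ Suc k / \<gamma>"] unfolding eq .
    with 2 fail show ?case
      by (auto simp: \<rho>_def elim!: resolves_mono simp del: upt_Suc)
  qed (use step.hyps in auto)
qed

text \<open>\<open>tower (log_star n)\<close> is only known to reach \<open>n\<close>; one level
  further the tower reaches \<open>2 ^ n > 4 * n\<close>, hence \<open>log_star n + 1\<close>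
  rounds. This inequality is where \<open>n \<ge> 5\<close> enters.\<close>

lemma resolves_tower:
  assumes \<gamma>: "0 < \<gamma>" "\<gamma> \<le> 1" and n: "n \<ge> 5" and ws: "length ws \<le> 2 * n"
  shows "resolves \<gamma> rk (map (\<lambda>i. reps \<gamma> (4 * real (tower i))) [0..<Suc (log_star (real n))]) ws
           (160 * real n / \<gamma>) (1 / real n)"
proof (rule resolves_mono[OF resolves_tower_from[OF \<gamma>, where m = "2 * real n"]])
  have "4 * n < 2 ^ n"
    using n by (induction n rule: dec_induct) auto
  also have "\<dots> \<le> tower (Suc (log_star (real n)))"
    using le_tower_log_star[of n] by (simp add: power_increasing)
  finally have "real (4 * n) < real (tower (Suc (log_star (real n))))" 
    unfolding of_nat_less_iff .
  then show "2 * (2 * real n) < real (tower (Suc (log_star (real n))))"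
    by simp
qed (use n ws in \<open>auto simp: field_simps\<close>)

subsection \<open>Pivots\<close>

text \<open>The filter makes every query list valid, whatever the earlier answers were. Among
  elements less than \<open>n\<close> nothing is lost, as no element is below itself.\<close>

definition pairs :: "nat \<Rightarrow> nat list \<Rightarrow> nat list \<Rightarrow> query list" where
  "pairs n xs ys = filter (\<lambda>(x, y). x < n \<and> y < n \<and> x \<noteq> y) (List.product xs ys)"

lemma set_pairs: "set (pairs n xs ys) = {(x, y). x \<in> set xs \<and> y \<in> set ys \<and> x < n \<and> y < n \<and> x \<noteq> y}"
  by (auto simp: pairs_def)

lemma length_pairs: "length (pairs n xs ys) \<le> length xs * length ys"
  unfolding pairs_def using length_filter_le[of _ "List.product xs ys"] by simp

lemma below_pairs:
  "(x, y) \<in> below rk (set (pairs n xs ys)) \<longleftrightarrow>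
     x \<in> set xs \<and> y \<in> set ys \<and> x < n \<and> y < n \<and> rk x < rk y"
  by (auto simp: below_def set_pairs)

text \<open>
  In a state \<open>(B, M)\<close>, the elements of \<open>B\<close> are known to have rank less than \<open>n div 2\<close>, those of \<open>M\<close>
  are undecided, and all others are known to have rank at least \<open>n div 2\<close>. Comparing \<open>M\<close> with a
  pivot \<open>v\<close> in \<open>M\<close> gives the exact rank of \<open>v\<close>, as all of \<open>B\<close> lies below \<open>v\<close>.
\<close>

definition bracket :: "nat \<Rightarrow> (nat \<Rightarrow> nat) \<Rightarrow> nat \<Rightarrow> nat set \<Rightarrow> nat set \<Rightarrow> bool" where
  "bracket n rk t B M \<longleftrightarrow>
     M \<subseteq> {..<n} \<and> B \<subseteq> {..<n} \<and> B \<inter> M = {} \<and>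
     (\<forall>x\<in>B. rk x < n div 2) \<and> (\<forall>y\<in>{..<n} - B - M. n div 2 \<le> rk y) \<and>
     (\<forall>x\<in>B. \<forall>y\<in>M. rk x < rk y) \<and>
     (\<forall>x\<in>M. \<forall>y\<in>{..<n} - B - M. rk x < rk y) \<and>
     (\<forall>x\<in>M. n div 2 \<le> rk x + t \<and> rk x < n div 2 + t)"

text \<open>The two premises negate the window condition of \<open>bracket\<close>. The bounds
  between element and pivot are not strict, so a pivot serves itself and the list of all elements
  covers with \<open>t = 0\<close>.\<close>

definition covers :: "nat \<Rightarrow> (nat \<Rightarrow> nat) \<Rightarrow> nat \<Rightarrow> nat list \<Rightarrow> bool" where
  "covers n rk t V \<longleftrightarrow> set V \<subseteq> {..<n} \<and>
     (\<forall>x<n. rk x + t < n div 2 \<longrightarrow> (\<exists>v\<in>set V. rk x \<le> rk v \<and> rk v < n div 2)) \<and>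
     (\<forall>x<n. n div 2 + t \<le> rk x \<longrightarrow> (\<exists>v\<in>set V. n div 2 \<le> rk v \<and> rk v \<le> rk x))"

definition low_pivots :: "nat \<Rightarrow> nat list \<Rightarrow> nat set \<Rightarrow> nat set \<Rightarrow> query set \<Rightarrow> nat set" where
  "low_pivots n V B M Y = {v \<in> M \<inter> set V. card B + card {x \<in> M. (x, v) \<in> Y} < n div 2}"

text \<open>The case \<open>x = v\<close> is needed because \<open>pairs\<close> never compares a
  pivot with itself.\<close>

definition refine_low :: "nat \<Rightarrow> nat list \<Rightarrow> nat set \<Rightarrow> nat set \<Rightarrow> query set \<Rightarrow> nat set" where
  "refine_low n V B M Y = B \<union> {x \<in> M. \<exists>v \<in> low_pivots n V B M Y. x = v \<or> (x, v) \<in> Y}"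

definition refine_mid :: "nat \<Rightarrow> nat list \<Rightarrow> nat set \<Rightarrow> nat set \<Rightarrow> query set \<Rightarrow> nat set" where
  "refine_mid n V B M Y =
     {x \<in> M - refine_low n V B M Y. \<forall>v \<in> M \<inter> set V - low_pivots n V B M Y. (x, v) \<in> Y}"

definition refine ::
  "nat \<Rightarrow> nat \<Rightarrow> nat list \<Rightarrow> nat set \<Rightarrow> nat set \<Rightarrow> (nat set \<Rightarrow> nat set \<Rightarrow> alg) \<Rightarrow> alg" where
  "refine n r V B M \<kappa> =
     resolve [r] (pairs n (filter (\<lambda>x. x \<in> M) [0..<n]) (filter (\<lambda>x. x \<in> M) V))
       (\<lambda>Y. \<kappa> (refine_low n V B M Y) (refine_mid n V B M Y))"

lemma card_rank_less:
  assumes rk: "rk permutes {..<n}" and "m \<le> n"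
  shows "card {x \<in> {..<n}. rk x < m} = m"
proof -
  have "rk ` {x \<in> {..<n}. rk x < m} = {..<m}"
  proof (intro equalityI subsetI)
    fix y assume "y \<in> {..<m}"
    then have "y \<in> rk ` {..<n}" using rk \<open>m \<le> n\<close> by (auto simp: permutes_image)
    then show "y \<in> rk ` {x \<in> {..<n}. rk x < m}" using \<open>y \<in> {..<m}\<close> by auto
  qed auto
  moreover have "inj_on rk {x \<in> {..<n}. rk x < m}"
    using permutes_inj_on[OF rk] .
  ultimately show ?thesis by (metis card_image card_lessThan)
qed

lemma card_rank_in:
  assumes rk: "rk permutes {..<n}" and "m \<le> k" "k \<le> n"
  shows "card {x \<in> {..<n}. m \<le> rk x \<and> rk x < k} = k - m"
proof -
  have "{x \<in> {..<n}. m \<le> rk x \<and> rk x < k} = {x \<in> {..<n}. rk x < k} - {x \<in> {..<n}. rk x < m}"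
    using \<open>m \<le> k\<close> by auto
  also have "card \<dots> = k - m"
    using assms by (subst card_Diff_subset) (auto simp: card_rank_less[OF rk, simplified])
  finally show ?thesis .
qed

lemma bracket_card:
  assumes rk: "rk permutes {..<n}" and M: "bracket n rk t B M"
    and t: "t \<le> n div 2"
  shows "card M \<le> 2 * t"
proof -
  have "card M \<le> card {x \<in> {..<n}. n div 2 - t \<le> rk x \<and> rk x < n div 2 + t}"
    using M by (intro card_mono) (auto simp: bracket_def)
  also have "\<dots> = 2 * t"
    using t by (subst card_rank_in[OF rk]) auto
  finally show ?thesis .
qed

text \<open>A pivot between an element of \<open>M\<close> and the middle can lie neither in
  \<open>B\<close> nor among the elements outside \<open>B\<close> and \<open>M\<close>. Hence it
  lies in \<open>M\<close>, was compared, and separates that element from the new middle part;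
  restricting \<open>V\<close> to \<open>M\<close> loses nothing.\<close>

lemma refine_bracket:
  assumes rk: "rk permutes {..<n}" and M: "bracket n rk t B M" and V: "covers n rk t' V"
  defines "Y \<equiv> below rk (set (pairs n (filter (\<lambda>x. x \<in> M) [0..<n]) (filter (\<lambda>x. x \<in> M) V)))"
  shows "bracket n rk t' (refine_low n V B M Y) (refine_mid n V B M Y)"
proof -
  note M' = M[unfolded bracket_def]
  note V' = V[unfolded covers_def]
  have inj: "rk x = rk y \<longleftrightarrow> x = y" for x y
    using permutes_inj[OF rk] by (auto dest: injD)
  have lt: "rk x < n \<longleftrightarrow> x < n" for x
    using permutes_in_image[OF rk, of x] by simp
  have Y: "(x, v) \<in> Y \<longleftrightarrow> rk x < rk v" if "x \<in> M" "v \<in> M" "v \<in> set V" for x v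
    using that M' unfolding Y_def below_pairs by auto
  have rank: "card B + card {x \<in> M. (x, v) \<in> Y} = rk v" if v: "v \<in> M" "v \<in> set V" for v
  proof -
    have "{x \<in> M. (x, v) \<in> Y} = {x \<in> M. rk x < rk v}" using Y v by auto
    then have "card B + card {x \<in> M. (x, v) \<in> Y} = card (B \<union> {x \<in> M. rk x < rk v})"
      using M' by (subst card_Un_disjoint) (auto intro: finite_subset[OF _ finite_lessThan])
    \<comment> \<open>No element outside \<open>B\<close> and \<open>M\<close> lies below
      \<open>v\<close>, so every smaller element is counted.\<close>
    also have "B \<union> {x \<in> M. rk x < rk v} = {x \<in> {..<n}. rk x < rk v}"
    proof (intro equalityI subsetI)
      fix x assume x: "x \<in> {x \<in> {..<n}. rk x < rk v}"
      then have "x \<in> B \<union> M"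
        using M' v by (metis (no_types, lifting) DiffI UnI1 UnI2 mem_Collect_eq not_less_iff_gr_or_eq)
      then show "x \<in> B \<union> {x \<in> M. rk x < rk v}" using x by auto
    qed (use M' v in auto)
    also have "card \<dots> = rk v"
      using v M' lt[of v] by (intro card_rank_less[OF rk]) auto
    finally show ?thesis .
  qed
  have low: "low_pivots n V B M Y = {v \<in> M \<inter> set V. rk v < n div 2}"
    using rank by (auto simp: low_pivots_def)
  have B': "refine_low n V B M Y = B \<union> {x \<in> M. \<exists>v \<in> M \<inter> set V. rk v < n div 2 \<and> rk x \<le> rk v}"
    unfolding refine_low_def low using Y by (auto simp: le_less inj)
  have M'': "refine_mid n V B M Y =
      {x \<in> M. (\<forall>v \<in> M \<inter> set V. rk v < n div 2 \<longrightarrow> rk v < rk x) \<and>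
              (\<forall>v \<in> M \<inter> set V. n div 2 \<le> rk v \<longrightarrow> rk x < rk v)}"
  proof -
    have "x \<notin> refine_low n V B M Y \<longleftrightarrow> (\<forall>v \<in> M \<inter> set V. rk v < n div 2 \<longrightarrow> rk v < rk x)" if "x \<in> M" for x
      using that M' unfolding B' not_less[symmetric] by blast
    moreover have "(\<forall>v \<in> M \<inter> set V - low_pivots n V B M Y. (x, v) \<in> Y) \<longleftrightarrow>
        (\<forall>v \<in> M \<inter> set V. n div 2 \<le> rk v \<longrightarrow> rk x < rk v)" if "x \<in> M" for x
    proof -
      have "M \<inter> set V - low_pivots n V B M Y = {v \<in> M \<inter> set V. n div 2 \<le> rk v}"
        by (auto simp: low)
      then show ?thesis using that Y by auto
    qed
    ultimately show ?thesis unfolding refine_mid_def by blast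
  qed
  have window1: "n div 2 \<le> rk x + t'" if x: "x \<in> refine_mid n V B M Y" for x
  proof (rule ccontr)
    assume "\<not> n div 2 \<le> rk x + t'"
    moreover have "x < n" "x \<in> M" using x M' by (auto simp: M'')
    ultimately obtain v where v: "v \<in> set V" "rk x \<le> rk v" "rk v < n div 2" "v < n"
      using V' by (metis lessThan_iff not_le subsetD)
    have "v \<notin> M" using x v by (auto simp: M'')
    moreover have "v \<notin> B" using M' v \<open>x \<in> M\<close> by (meson not_le)
    ultimately have "n div 2 \<le> rk v" using M' v by auto
    then show False using v by simp
  qed
  have window2: "rk x < n div 2 + t'" if x: "x \<in> refine_mid n V B M Y" for x
  proof (rule ccontr)
    assume "\<not> rk x < n div 2 + t'"
    moreover have "x < n" "x \<in> M" using x M' by (auto simp: M'')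
    ultimately obtain v where v: "v \<in> set V" "rk v \<le> rk x" "n div 2 \<le> rk v" "v < n"
      using V' by (metis lessThan_iff not_le subsetD)
    have "v \<notin> M" using x v by (auto simp: M'')
    moreover have "v \<notin> B" using M' v by (meson not_le)
    ultimately have "rk x < rk v" using M' v \<open>x \<in> M\<close> by auto
    then show False using v by simp
  qed
  have out: "\<exists>v \<in> M \<inter> set V. n div 2 \<le> rk v \<and> rk v \<le> rk y"
    if "y \<in> M" "y \<notin> refine_low n V B M Y" "y \<notin> refine_mid n V B M Y" for y
    using that unfolding B' M'' by (auto simp: not_less) (metis IntI not_le)+
  show ?thesis
    unfolding bracket_def
  proof (intro conjI ballI)
    show "refine_mid n V B M Y \<subseteq> {..<n}" "refine_low n V B M Y \<subseteq> {..<n}"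
      using M' by (auto simp: B' M'')
    show "refine_low n V B M Y \<inter> refine_mid n V B M Y = {}"
      using M' by (auto simp: B' M'')
    show "rk x < n div 2" if "x \<in> refine_low n V B M Y" for x
      using M' that by (auto simp: B')
    show "n div 2 \<le> rk y" if "y \<in> {..<n} - refine_low n V B M Y - refine_mid n V B M Y" for y
    proof (cases "y \<in> M")
      case True
      then show ?thesis using out[of y] that by auto
    next
      case False
      then show ?thesis using M' that by (auto simp: B')
    qed
    show "rk x < rk y" if "x \<in> refine_low n V B M Y" "y \<in> refine_mid n V B M Y" for x y
      using M' that unfolding B' M'' by (auto intro: le_less_trans)
    show "rk x < rk y"
      if xy: "x \<in> refine_mid n V B M Y" "y \<in> {..<n} - refine_low n V B M Y - refine_mid n V B M Y" for x y
    proof (cases "y \<in> M")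
      case True
      then obtain v where "v \<in> M \<inter> set V" "n div 2 \<le> rk v" "rk v \<le> rk y"
        using out[of y] xy by auto
      then show ?thesis using xy unfolding M'' by (auto intro: less_le_trans)
    next
      case False
      then show ?thesis using M' that by (auto simp: B' M'')
    qed
  qed (use window1 window2 in auto)
qed

section \<open>Two pivots around the middle from a sorted sample\<close>

lemma finite_argmax:
  fixes f :: "'a \<Rightarrow> 'b :: linorder"
  assumes "finite A" "A \<noteq> {}"
  shows "\<exists>x\<in>A. \<forall>y\<in>A. f y \<le> f x"
proof -
  have "Max (f ` A) \<in> f ` A" using assms by (intro Max_in) auto
  then obtain x where "x \<in> A" "f x = Max (f ` A)" by auto
  with assms show ?thesis by (intro bexI[of _ x]) auto
qed

lemma finite_argmin:
  fixes f :: "'a \<Rightarrow> 'b :: linorder"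
  assumes "finite A" "A \<noteq> {}"
  shows "\<exists>x\<in>A. \<forall>y\<in>A. f x \<le> f y"
proof -
  have "Min (f ` A) \<in> f ` A" using assms by (intro Min_in) auto
  then obtain x where "x \<in> A" "f x = Min (f ` A)" by auto
  with assms show ?thesis by (intro bexI[of _ x]) auto
qed

text \<open>An order statistic of the sample, found from the answers alone. On contradictory answers
  \<open>SOME\<close> may return any number; \<open>pairs\<close> filters it out if it is not an
  element.\<close>

definition lower_pivot :: "nat list \<Rightarrow> real \<Rightarrow> query set \<Rightarrow> nat" where
  "lower_pivot S a Y =
     (let C = {v \<in> set S. real (length (filter (\<lambda>x. (x, v) \<in> Y) S)) < a}
      in SOME l. l \<in> C \<and> (\<forall>v\<in>C. v \<noteq> l \<longrightarrow> (v, l) \<in> Y))"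

definition upper_pivot :: "nat list \<Rightarrow> real \<Rightarrow> query set \<Rightarrow> nat" where
  "upper_pivot S a Y =
     (let C = {v \<in> set S. real (length (filter (\<lambda>x. (v, x) \<in> Y) S)) < a}
      in SOME u. u \<in> C \<and> (\<forall>v\<in>C. v \<noteq> u \<longrightarrow> (u, v) \<in> Y))"

text \<open>The empirical distribution function of the sample, unnormalised and with
  multiplicity.\<close>

definition rank_count :: "(nat \<Rightarrow> nat) \<Rightarrow> nat list \<Rightarrow> nat \<Rightarrow> nat" where
  "rank_count rk S m = length (filter (\<lambda>x. rk x < m) S)"

lemma rank_count_mono: "m \<le> m' \<Longrightarrow> rank_count rk S m \<le> rank_count rk S m'"
  unfolding rank_count_def by (induction S) auto

lemma rank_count_compl: "length (filter (\<lambda>x. m \<le> rk x) S) = length S - rank_count rk S m"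
  unfolding rank_count_def using sum_length_filter_compl[of "\<lambda>x. rk x < m" S]
  by (simp add: not_less)

lemma rank_count_le: "rank_count rk S m \<le> length S"
  unfolding rank_count_def by simp

text \<open>The least sample element of rank at least \<open>m\<close> has the same count as
  \<open>m\<close>, so it is a candidate; an element of rank at least \<open>h\<close> has count at
  least \<open>a\<close> and is none. The largest candidate therefore lies in between.\<close>

lemma lower_pivot_bounds:
  assumes rk: "rk permutes {..<n}" and S: "set S \<subseteq> {..<n}"
    and a: "a \<le> real (rank_count rk S h)" "real (rank_count rk S m) < a"
  defines "l \<equiv> lower_pivot S a (below rk (set (pairs n S S)))"
  shows "l < n" "m \<le> rk l" "rk l < h"
proof -
  let ?Y = "below rk (set (pairs n S S))"
  define C where "C = {v \<in> set S. real (length (filter (\<lambda>x. (x, v) \<in> ?Y) S)) < a}"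
  have inj: "rk x = rk y \<longleftrightarrow> x = y" for x y
    using permutes_inj[OF rk] by (auto dest: injD)
  have Y: "(x, v) \<in> ?Y \<longleftrightarrow> rk x < rk v" if "x \<in> set S" "v \<in> set S" for x v
    using that S by (auto simp: below_pairs)
  have "length (filter (\<lambda>x. (x, v) \<in> ?Y) S) = rank_count rk S (rk v)" if "v \<in> set S" for v
    unfolding rank_count_def using Y that by (metis (mono_tags, lifting) filter_cong)
  then have C: "C = {v \<in> set S. real (rank_count rk S (rk v)) < a}"
    by (auto simp: C_def)
  \<comment> \<open>Otherwise the whole sample lies below \<open>m\<close>, and the count at
    \<open>h\<close> cannot exceed the one at \<open>m\<close>.\<close>
  have "\<exists>x \<in> set S. m \<le> rk x"
  proof (rule ccontr)
    assume "\<not> ?thesis"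
    then have "rank_count rk S m = length S"
      unfolding rank_count_def by (subst filter_True) (auto simp: not_le)
    then show False using a rank_count_le[of rk S h] by simp
  qed
  then obtain x where x: "x \<in> set S" "m \<le> rk x" "\<forall>y\<in>set S. m \<le> rk y \<longrightarrow> rk x \<le> rk y"
    using finite_argmin[of "{x \<in> set S. m \<le> rk x}" rk] by auto
  have "filter (\<lambda>y. rk y < rk x) S = filter (\<lambda>y. rk y < m) S"
    using x by (intro filter_cong) (auto simp: not_le[symmetric])
  then have "rank_count rk S (rk x) = rank_count rk S m"
    by (simp add: rank_count_def)
  then have xC: "x \<in> C" using a x(1) by (auto simp: C)
  then obtain l0 where l0: "l0 \<in> C" "\<forall>y\<in>C. rk y \<le> rk l0"
    using finite_argmax[of C rk] by (auto simp: C)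
  have "l0 \<in> C \<and> (\<forall>v\<in>C. v \<noteq> l0 \<longrightarrow> (v, l0) \<in> ?Y)"
    using l0 Y by (auto simp: C le_less inj)
  then have l: "l \<in> C \<and> (\<forall>v\<in>C. v \<noteq> l \<longrightarrow> (v, l) \<in> ?Y)"
    unfolding l_def lower_pivot_def Let_def C_def by (rule someI)
  show "l < n" using l S by (auto simp: C)
  show "m \<le> rk l"
  proof (cases "x = l")
    case False
    then have "rk x < rk l" using l xC Y[of x l] by (auto simp: C)
    then show ?thesis using x by simp
  qed (use x in simp)
  show "rk l < h"
  proof (rule ccontr)
    assume "\<not> rk l < h"
    then have "rank_count rk S h \<le> rank_count rk S (rk l)" by (intro rank_count_mono) simp
    then show False using l a by (auto simp: C)
  qed
qed

text \<open>Mirror image of \<open>lower_pivot_bounds\<close>. The rank interval is again closed on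
  the left, so candidates are judged by the members strictly above them, but \<open>h\<close> by
  those at or above it.\<close>

lemma upper_pivot_bounds:
  assumes rk: "rk permutes {..<n}" and S: "set S \<subseteq> {..<n}"
    and a: "a \<le> real (length S) - real (rank_count rk S h)" "real (length S) - real (rank_count rk S m) < a"
  defines "u \<equiv> upper_pivot S a (below rk (set (pairs n S S)))"
  shows "u < n" "h \<le> rk u" "rk u < m"
proof -
  let ?Y = "below rk (set (pairs n S S))"
  let ?G = "\<lambda>k. length (filter (\<lambda>x. k < rk x) S)"
  define C where "C = {v \<in> set S. real (length (filter (\<lambda>x. (v, x) \<in> ?Y) S)) < a}"
  have inj: "rk x = rk y \<longleftrightarrow> x = y" for x y
    using permutes_inj[OF rk] by (auto dest: injD)
  have Y: "(v, x) \<in> ?Y \<longleftrightarrow> rk v < rk x" if "x \<in> set S" "v \<in> set S" for x v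
    using that S by (auto simp: below_pairs)
  have ge: "length (filter (\<lambda>x. k \<le> rk x) S) + rank_count rk S k = length S" for k
    using rank_count_compl[where m = k and rk = rk and S = S] rank_count_le[of rk S k] by simp
  have "length (filter (\<lambda>x. (v, x) \<in> ?Y) S) = ?G (rk v)" if "v \<in> set S" for v
    using Y that by (metis (mono_tags, lifting) filter_cong)
  then have C: "C = {v \<in> set S. real (?G (rk v)) < a}"
    by (auto simp: C_def)
  have "\<exists>x \<in> set S. rk x < m"
  proof (rule ccontr)
    assume "\<not> ?thesis"
    then have "rank_count rk S m = 0"
      unfolding rank_count_def by (subst filter_False) auto
    then show False using a by simp
  qed
  then obtain x where x: "x \<in> set S" "rk x < m" "\<forall>y\<in>set S. rk y < m \<longrightarrow> rk y \<le> rk x"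
    using finite_argmax[of "{x \<in> set S. rk x < m}" rk] by auto
  have "filter (\<lambda>y. rk x < rk y) S = filter (\<lambda>y. m \<le> rk y) S"
    using x by (intro filter_cong) (auto simp: not_le[symmetric])
  then have "?G (rk x) = length (filter (\<lambda>y. m \<le> rk y) S)" by simp
  then have xC: "x \<in> C" using a x(1) ge[of m] by (auto simp: C)
  then obtain u0 where u0: "u0 \<in> C" "\<forall>y\<in>C. rk u0 \<le> rk y"
    using finite_argmin[of C rk] by (auto simp: C)
  have "u0 \<in> C \<and> (\<forall>v\<in>C. v \<noteq> u0 \<longrightarrow> (u0, v) \<in> ?Y)"
    using u0 Y by (auto simp: C le_less inj)
  then have u: "u \<in> C \<and> (\<forall>v\<in>C. v \<noteq> u \<longrightarrow> (u, v) \<in> ?Y)"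
    unfolding u_def upper_pivot_def Let_def C_def by (rule someI)
  show "u < n" using u S by (auto simp: C)
  show "rk u < m"
  proof (cases "x = u")
    case False
    then have "rk u < rk x" using u xC Y[of x u] by (auto simp: C)
    then show ?thesis using x by simp
  qed (use x in simp)
  show "h \<le> rk u"
  proof (rule ccontr)
    assume "\<not> h \<le> rk u"
    then have "length (filter (\<lambda>x. h \<le> rk x) S) \<le> ?G (rk u)"
      by (induction S) auto
    then show False using u a ge[of h] by (auto simp: C)
  qed
qed

definition start_low :: "nat \<Rightarrow> nat \<Rightarrow> query set \<Rightarrow> nat set" where
  "start_low n l Y = {x \<in> {..<n}. x = l \<or> (x, l) \<in> Y}"

definition start_mid :: "nat \<Rightarrow> nat \<Rightarrow> nat \<Rightarrow> query set \<Rightarrow> nat set" where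
  "start_mid n l u Y = {x \<in> {..<n} - start_low n l Y. (x, u) \<in> Y}"

lemma start_bracket:
  assumes rk: "rk permutes {..<n}" and l: "l < n" "n div 2 \<le> rk l + t" "rk l < n div 2"
    and u: "u < n" "n div 2 \<le> rk u" "rk u < n div 2 + t"
  defines "Y \<equiv> below rk (set (pairs n [0..<n] [l, u]))"
  shows "bracket n rk t (start_low n l Y) (start_mid n l u Y)"
proof -
  have inj: "rk x = rk y \<longleftrightarrow> x = y" for x y
    using permutes_inj[OF rk] by (auto dest: injD)
  have Y: "(x, v) \<in> Y \<longleftrightarrow> rk x < rk v" if "x < n" "v \<in> {l, u}" for x v
    using that l u by (auto simp: Y_def below_pairs)
  have B: "start_low n l Y = {x \<in> {..<n}. rk x \<le> rk l}"
    unfolding start_low_def using Y by (auto simp: le_less inj)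
  have M: "start_mid n l u Y = {x \<in> {..<n}. rk l < rk x \<and> rk x < rk u}"
    unfolding start_mid_def B using Y by auto
  show ?thesis
    using l u unfolding bracket_def B M by (auto simp: not_le not_less)
qed

section \<open>The algorithm for given samples and its budgets\<close>

definition partition_alg ::
  "nat \<Rightarrow> nat \<Rightarrow> nat list \<Rightarrow> real \<Rightarrow> real \<Rightarrow> nat list \<Rightarrow> nat list \<Rightarrow> nat list \<Rightarrow> alg" where
  "partition_alg n r rs a a' S V1 V2 =
     resolve [r] (pairs n S S) (\<lambda>Y.
       let l = lower_pivot S a Y; u = upper_pivot S a' Y in
       resolve rs (pairs n [0..<n] [l, u]) (\<lambda>Y.
         refine n r V1 (start_low n l Y) (start_mid n l u Y) (\<lambda>B M.
         refine n r V2 B M (\<lambda>B M.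
         refine n r [0..<n] B M (\<lambda>B M.
           Output ({..<n} - B) (B \<inter> {..<n}))))))"

lemma valid_refine:
  assumes "\<And>B M. valid_alg n (\<kappa> B M)"
  shows "valid_alg n (refine n r V B M \<kappa>)"
  unfolding refine_def using assms by (intro valid_resolve) (auto simp: set_pairs)

text \<open>Validity is demanded for all answer sequences, even impossible ones:
  \<open>pairs\<close> yields proper queries only, and the output is a partition for any set
  \<open>B\<close>.\<close>

lemma valid_partition_alg: "valid_alg n (partition_alg n r rs a a' S V1 V2)"
  unfolding partition_alg_def Let_def
  by (intro valid_resolve valid_refine) (auto simp: set_pairs)

definition window_count :: "nat \<Rightarrow> (nat \<Rightarrow> nat) \<Rightarrow> nat \<Rightarrow> nat list \<Rightarrow> nat" where
  "window_count n rk t V = length (filter (\<lambda>x. n div 2 \<le> rk x + t \<and> rk x < n div 2 + t) V)"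

text \<open>With \<open>t = 4 * ln n\<close> a comparison stays open with probability at most
  \<open>1 / n ^ 4\<close>. There are at most \<open>n\<close> comparisons, because
  \<open>ln n \<ge> 1\<close> for \<open>n \<ge> 3\<close>.\<close>

lemma resolves_log_reps:
  assumes \<gamma>: "0 < \<gamma>" "\<gamma> \<le> 1" and n: "n \<ge> 3" and ws: "real (length ws) * ln (real n) \<le> real n"
  shows "resolves \<gamma> rk [reps \<gamma> (4 * ln (real n))] ws (8 * real n / \<gamma>) (1 / real n)"
proof -
  have "exp (1 :: real) \<le> real n"
    using exp_le n by linarith
  then have ln: "1 \<le> ln (real n)"
    using n by (subst ln_ge_iff) auto
  have len: "real (length ws) \<le> real n"
    using mult_left_mono[OF ln, of "real (length ws)"] ws by simp
  have "exp (4 * ln (real n)) = real n ^ 4"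
    using n exp_of_nat_mult[of 4 "ln (real n)"] by simp
  then have "exp (- (4 * ln (real n))) = 1 / real n ^ 4"
    by (simp only: exp_minus inverse_eq_divide)
  then have "real (length ws) * exp (- (4 * ln (real n))) \<le> real n * (1 / real n ^ 4)"
    using len by (metis mult_right_mono zero_le_divide_1_iff zero_le_power of_nat_0_le_iff)
  also have "\<dots> = 1 / real n ^ 3"
    using n by (simp add: power_eq_if)
  also have "\<dots> \<le> 1 / (3 ^ 2 * real n)"
  proof (intro divide_left_mono)
    have "(3 :: real) ^ 2 \<le> real n ^ 2" using n by (intro power_mono) auto
    then show "3 ^ 2 * real n \<le> real n ^ 3"
      using n by (simp add: power3_eq_cube power2_eq_square mult_right_mono)
  qed (use n in auto)
  finally have small: "real (length ws) * exp (- (4 * ln (real n))) \<le> 1 / (9 * real n)" by simp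
  have "1 / (9 * real n) \<le> 1 / 2" using n by (simp add: field_simps)
  with small have half: "real (length ws) * exp (- (4 * ln (real n))) \<le> 1 / 2" by linarith
  show ?thesis
  proof (rule resolves_mono[OF resolves_single[OF \<gamma> _ half]])
    have "2 * (4 * ln (real n)) / \<gamma> * real (length ws) = 8 * (real (length ws) * ln (real n)) / \<gamma>"
      by simp
    also have "\<dots> \<le> 8 * real n / \<gamma>" using ws \<gamma> by (intro divide_right_mono) auto
    finally show "2 * (4 * ln (real n)) / \<gamma> * real (length ws) \<le> 8 * real n / \<gamma>" .
    have "4 * (real (length ws) * exp (- (4 * ln (real n)))) \<le> 4 * (1 / (9 * real n))"
      using small by (intro mult_left_mono) auto
    also have "\<dots> \<le> 1 / real n" using n by (simp add: field_simps)
    finally show "4 * (real (length ws) * exp (- (4 * ln (real n)))) \<le> 1 / real n" .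
  qed (use ln in auto)
qed

lemma resolvesD:
  assumes "resolves \<gamma> rk rs ws c \<epsilon>" "E \<ge> 0" "success \<gamma> n rk T C E (\<kappa> (below rk (set ws)))"
  shows "success \<gamma> n rk (length rs + T) (c + C) (\<epsilon> + E) (resolve rs ws \<kappa>)"
  using assms unfolding resolves_def by blast

text \<open>\<open>M\<close> lies in the window of half-width \<open>t\<close>, so at most
  \<open>2 * t\<close> elements meet at most \<open>c\<close> pivots: few enough for a single round
  of \<open>resolves_log_reps\<close>.\<close>

lemma success_refine:
  assumes rk: "rk permutes {..<n}" and \<gamma>: "0 < \<gamma>" "\<gamma> \<le> 1" and n: "n \<ge> 3" and "E \<ge> 0"
    and M: "bracket n rk t B M" and t: "t \<le> n div 2" and V: "covers n rk t' V"
    and c: "real (window_count n rk t V) \<le> c" "2 * real t * c * ln (real n) \<le> real n"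
    and \<kappa>: "\<And>B M. bracket n rk t' B M \<Longrightarrow> success \<gamma> n rk T C E (\<kappa> B M)"
  shows "success \<gamma> n rk (Suc T) (8 * real n / \<gamma> + C) (1 / real n + E)
           (refine n (reps \<gamma> (4 * ln (real n))) V B M \<kappa>)"
proof -
  let ?xs = "filter (\<lambda>x. x \<in> M) [0..<n]" and ?ys = "filter (\<lambda>x. x \<in> M) V"
  have "length ?xs = card M"
  proof -
    have "set ?xs = M" using M by (auto simp: bracket_def)
    then show ?thesis by (metis distinct_card distinct_filter distinct_upt)
  qed
  then have xs: "length ?xs \<le> 2 * t" using bracket_card[OF rk M t] by simp
  have "length ?ys \<le> window_count n rk t V"
    using M unfolding window_count_def bracket_def by (induction V) auto
  then have ys: "real (length ?ys) \<le> c" using c by linarith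
  have "real (length (pairs n ?xs ?ys)) \<le> real (length ?xs) * real (length ?ys)"
    using length_pairs[of n ?xs ?ys] by (simp flip: of_nat_mult)
  also have "\<dots> \<le> real (2 * t) * c"
    using xs ys by (intro mult_mono) auto
  finally have "real (length (pairs n ?xs ?ys)) * ln (real n) \<le> 2 * real t * c * ln (real n)"
    using n by (intro mult_right_mono) auto
  then have "resolves \<gamma> rk [reps \<gamma> (4 * ln (real n))] (pairs n ?xs ?ys) (8 * real n / \<gamma>) (1 / real n)"
    using c by (intro resolves_log_reps \<gamma> n) linarith
  from resolvesD[OF this \<open>E \<ge> 0\<close>,
      where \<kappa> = "\<lambda>Y. \<kappa> (refine_low n V B M Y) (refine_mid n V B M Y)",
      OF \<kappa>[OF refine_bracket[OF rk M V]]]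
  show ?thesis by (simp add: refine_def)
qed

lemma success_Output:
  assumes "rk permutes {..<n}" "bracket n rk 0 B M"
  shows "success \<gamma> n rk 0 0 0 (Output ({..<n} - B) (B \<inter> {..<n}))"
proof -
  \<comment> \<open>The window of half-width 0 contains no rank.\<close>
  have "M = {}" using assms unfolding bracket_def by fastforce
  then have B: "i \<in> B \<longleftrightarrow> rk i < n div 2" if "i < n" for i
    using assms that unfolding bracket_def by (auto simp: not_less[symmetric])
  \<comment> \<open>For odd \<open>n\<close> the rank \<open>n div 2\<close> is the median itself
    and falls under neither requirement; for even \<open>n\<close> the median lies between
    \<open>n div 2 - 1\<close> and \<open>n div 2\<close>.\<close>
  have "solves_partition n rk \<lparr>queries = 0, rounds = 0, accepted = {..<n} - B, rejected = B \<inter> {..<n}\<rparr>"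
    unfolding solves_partition_def median_rank_def using B by auto
  then show ?thesis by (simp add: success_def)
qed

lemma covers_all: "covers n rk 0 [0..<n]"
  unfolding covers_def by auto

lemma window_count_all:
  assumes rk: "rk permutes {..<n}" and "t \<le> n div 2"
  shows "window_count n rk t [0..<n] = 2 * t"
proof -
  have "window_count n rk t [0..<n] = card (set (filter (\<lambda>x. n div 2 \<le> rk x + t \<and> rk x < n div 2 + t) [0..<n]))"
    unfolding window_count_def by (rule distinct_card[symmetric]) simp
  also have "set (filter (\<lambda>x. n div 2 \<le> rk x + t \<and> rk x < n div 2 + t) [0..<n]) =
      {x \<in> {..<n}. n div 2 - t \<le> rk x \<and> rk x < n div 2 + t}"
    by auto
  also have "card \<dots> = 2 * t"
    using assms by (subst card_rank_in[OF rk]) auto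
  finally show ?thesis .
qed

text \<open>Rounds: one for the sample, \<open>log_star n + 1\<close> for the two pivots, three
  refinements. Queries: \<open>160 + 4 * 8 = 192\<close> times \<open>n / \<gamma>\<close>. Each of
  the five stages fails with probability at most \<open>1 / n\<close>.\<close>

lemma success_partition_alg:
  assumes rk: "rk permutes {..<n}" and \<gamma>: "0 < \<gamma>" "\<gamma> \<le> 1" and n: "n \<ge> 5"
    and S: "set S \<subseteq> {..<n}" "(real (length S))\<^sup>2 * ln (real n) \<le> real n"
    and a: "a \<le> real (rank_count rk S (n div 2))" "real (rank_count rk S (n div 2 - t)) < a"
    and a': "a' \<le> real (length S) - real (rank_count rk S (n div 2))"
            "real (length S) - real (rank_count rk S (n div 2 + t)) < a'"
    and V1: "covers n rk t1 V1" "real (window_count n rk t V1) \<le> c1" "2 * real t * c1 * ln (real n) \<le> real n"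
    and V2: "covers n rk t2 V2" "real (window_count n rk t1 V2) \<le> c2" "2 * real t1 * c2 * ln (real n) \<le> real n"
    and t: "t \<le> n div 2" "t1 \<le> n div 2" "t2 \<le> n div 2" "4 * (real t2)\<^sup>2 * ln (real n) \<le> real n"
  shows "success \<gamma> n rk (log_star (real n) + 5) (192 * real n / \<gamma>) (5 / real n)
    (partition_alg n (reps \<gamma> (4 * ln (real n)))
       (map (\<lambda>i. reps \<gamma> (4 * real (tower i))) [0..<Suc (log_star (real n))]) a a' S V1 V2)"
proof -
  let ?r = "reps \<gamma> (4 * ln (real n))"
  define out where "out = (\<lambda>(B :: nat set) (M :: nat set). Output ({..<n} - B) (B \<inter> {..<n}))"
  define \<kappa>3 where "\<kappa>3 = (\<lambda>B M. refine n ?r [0..<n] B M out)"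
  define \<kappa>2 where "\<kappa>2 = (\<lambda>B M. refine n ?r V2 B M \<kappa>3)"
  define \<kappa>1 where "\<kappa>1 = (\<lambda>B M. refine n ?r V1 B M \<kappa>2)"
  let ?q = "8 * real n / \<gamma>" and ?e = "1 / real n"
  have n3: "n \<ge> 3" using n by simp
  \<comment> \<open>The stages are treated from the last to the first, since each needs the
    guarantee of its continuation.\<close>
  have s3: "success \<gamma> n rk (Suc 0) (?q + 0) (?e + 0) (\<kappa>3 B M)" if "bracket n rk t2 B M" for B M
    unfolding \<kappa>3_def
  proof (rule success_refine[OF rk \<gamma> n3 _ that t(3) covers_all])
    show "real (window_count n rk t2 [0..<n]) \<le> 2 * real t2"
      using window_count_all[OF rk t(3)] by simp
    show "2 * real t2 * (2 * real t2) * ln (real n) \<le> real n"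
      using t(4) by (simp add: power2_eq_square algebra_simps)
    show "success \<gamma> n rk 0 0 0 (out B M)" if "bracket n rk 0 B M" for B M
      unfolding out_def by (rule success_Output[OF rk that])
  qed simp
  have s2: "success \<gamma> n rk (Suc (Suc 0)) (?q + (?q + 0)) (?e + (?e + 0)) (\<kappa>2 B M)"
    if "bracket n rk t1 B M" for B M
    unfolding \<kappa>2_def by (rule success_refine[OF rk \<gamma> n3 _ that t(2) V2 s3]) auto
  have s1: "success \<gamma> n rk (Suc (Suc (Suc 0))) (?q + (?q + (?q + 0))) (?e + (?e + (?e + 0))) (\<kappa>1 B M)"
    if "bracket n rk t B M" for B M
    unfolding \<kappa>1_def by (rule success_refine[OF rk \<gamma> n3 _ that t(1) V1 s2]) auto
  define l where "l = lower_pivot S a (below rk (set (pairs n S S)))"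
  define u where "u = upper_pivot S a' (below rk (set (pairs n S S)))"
  have l: "l < n" "n div 2 - t \<le> rk l" "rk l < n div 2"
    unfolding l_def using lower_pivot_bounds[OF rk S(1) a] by auto
  have u: "u < n" "n div 2 \<le> rk u" "rk u < n div 2 + t"
    unfolding u_def using upper_pivot_bounds[OF rk S(1) a'] by auto
  define rs where "rs = map (\<lambda>i. reps \<gamma> (4 * real (tower i))) [0..<Suc (log_star (real n))]"
  have lrs: "length rs = Suc (log_star (real n))" by (simp add: rs_def)
  have "resolves \<gamma> rk rs (pairs n [0..<n] [l, u]) (160 * real n / \<gamma>) (1 / real n)"
    unfolding rs_def
  proof (rule resolves_tower[OF \<gamma> n])
    show "length (pairs n [0..<n] [l, u]) \<le> 2 * n"
      using length_pairs[of n "[0..<n]" "[l, u]"] by simp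
  qed
  from resolvesD[OF this, where \<kappa> = "\<lambda>Y. \<kappa>1 (start_low n l Y) (start_mid n l u Y)",
      OF _ s1[OF start_bracket[OF rk l(1) _ l(3) u]]] l(2)
  have "success \<gamma> n rk (length rs + Suc (Suc (Suc 0))) (160 * real n / \<gamma> + (?q + (?q + (?q + 0))))
      (?e + (?e + (?e + (?e + 0))))
      (resolve rs (pairs n [0..<n] [l, u]) (\<lambda>Y. \<kappa>1 (start_low n l Y) (start_mid n l u Y)))"
    by simp
  moreover have "resolves \<gamma> rk [?r] (pairs n S S) ?q ?e"
  proof (rule resolves_log_reps[OF \<gamma> n3])
    have "real (length (pairs n S S)) \<le> (real (length S))\<^sup>2"
      using length_pairs[of n S S] by (simp add: power2_eq_square flip: of_nat_mult)
    then have "real (length (pairs n S S)) * ln (real n) \<le> (real (length S))\<^sup>2 * ln (real n)"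
      using n by (intro mult_right_mono) auto
    then show "real (length (pairs n S S)) * ln (real n) \<le> real n" using S by linarith
  qed
  ultimately have "success \<gamma> n rk (length [?r] + (length rs + Suc (Suc (Suc 0))))
      (?q + (160 * real n / \<gamma> + (?q + (?q + (?q + 0)))))
      (?e + (?e + (?e + (?e + (?e + 0)))))
      (resolve [?r] (pairs n S S) (\<lambda>Y.
       let l = lower_pivot S a Y; u = upper_pivot S a' Y in
       resolve rs (pairs n [0..<n] [l, u]) (\<lambda>Y. \<kappa>1 (start_low n l Y) (start_mid n l u Y))))"
    by (intro resolvesD) (simp_all add: Let_def l_def u_def)
  then show ?thesis
    unfolding partition_alg_def rs_def[symmetric] \<kappa>1_def \<kappa>2_def \<kappa>3_def out_def
    by (rule success_mono) (simp_all add: lrs add_divide_distrib[symmetric])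
qed

subsection \<open>Random samples\<close>

text \<open>Sampling with replacement: counts are exactly binomial, and repeated members do no
  harm.\<close>

definition sample :: "nat \<Rightarrow> nat \<Rightarrow> nat list pmf" where
  "sample s n = replicate_pmf s (pmf_of_set {..<n})"

lemma sample_set:
  assumes "n > 0" "xs \<in> set_pmf (sample s n)"
  shows "set xs \<subseteq> {..<n}" "length xs = s"
proof -
  have "set_pmf (pmf_of_set {..<n}) = {..<n}" using assms(1) by (intro set_pmf_of_set) auto
  then show "set xs \<subseteq> {..<n}" "length xs = s"
    using assms(2) by (auto simp: sample_def set_replicate_pmf)
qed

lemma map_replicate_pmf: "map_pmf (map f) (replicate_pmf s p) = replicate_pmf s (map_pmf f p)"
proof (induction s)
  case (Suc s)
  have "map_pmf (map f) (replicate_pmf (Suc s) p) =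
      bind_pmf p (\<lambda>x. map_pmf ((#) (f x)) (map_pmf (map f) (replicate_pmf s p)))"
    by (simp add: map_pmf_def bind_assoc_pmf bind_return_pmf)
  also have "\<dots> = replicate_pmf (Suc s) (map_pmf f p)"
    unfolding Suc by (simp add: map_pmf_def bind_assoc_pmf bind_return_pmf)
  finally show ?case .
qed simp

lemma sample_count:
  assumes "n > 0"
  shows "map_pmf (\<lambda>xs. length (filter Q xs)) (sample s n) =
         binomial_pmf s (real (card {x \<in> {..<n}. Q x}) / real n)"
proof -
  let ?q = "real (card {x \<in> {..<n}. Q x}) / real n"
  have "card {x \<in> {..<n}. Q x} \<le> card {..<n}" by (intro card_mono) auto
  then have q: "0 \<le> ?q" "?q \<le> 1" using assms by (auto simp: field_simps)
  have ne: "{..<n} \<noteq> {}" using assms by auto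
  have pmf_Q: "pmf (map_pmf Q (pmf_of_set {..<n})) True = ?q"
    using ne by (simp add: pmf_map measure_pmf_of_set vimage_def Int_def)
  have "map_pmf Q (pmf_of_set {..<n}) = bernoulli_pmf ?q"
  proof (rule pmf_eqI)
    fix b
    show "pmf (map_pmf Q (pmf_of_set {..<n})) b = pmf (bernoulli_pmf ?q) b"
      using pmf_Q q pmf_False_conv_True[of "map_pmf Q (pmf_of_set {..<n})"] by (cases b) auto
  qed
  then have "binomial_pmf s ?q =
      map_pmf (length \<circ> filter id) (map_pmf (map Q) (sample s n))"
    using q by (simp add: binomial_pmf_altdef sample_def map_replicate_pmf)
  also have "\<dots> = map_pmf (\<lambda>xs. length (filter Q xs)) (sample s n)"
    by (simp add: pmf.map_comp o_def filter_map)
  finally show ?thesis ..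
qed

text \<open>Hoeffding's inequality for the binomial count of \<open>sample_count\<close>.\<close>

lemma sample_deviation:
  assumes "n > 0" "s > 0" "d \<ge> 0"
  shows "measure_pmf.prob (sample s n)
      {xs. d \<le> \<bar>real (length (filter Q xs)) - real s * real (card {x \<in> {..<n}. Q x}) / real n\<bar>}
    \<le> 2 * exp (- 2 * d\<^sup>2 / real s)"
proof -
  let ?q = "real (card {x \<in> {..<n}. Q x}) / real n"
  have "card {x \<in> {..<n}. Q x} \<le> card {..<n}" by (intro card_mono) auto
  then have q: "0 \<le> ?q" "?q \<le> 1" using assms by (auto simp: field_simps)
  interpret binomial_distribution s ?q
    by unfold_locales (use q in auto)
  have "measure_pmf.prob (sample s n)
      {xs. d \<le> \<bar>real (length (filter Q xs)) - real s * ?q\<bar>} =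
    measure_pmf.prob (map_pmf (\<lambda>xs. length (filter Q xs)) (sample s n))
      {k. d \<le> \<bar>real k - real s * ?q\<bar>}"
    by (simp add: vimage_def)
  also have "\<dots> \<le> 2 * exp (- 2 * d\<^sup>2 / real s)"
    unfolding sample_count[OF assms(1)] using assms by (intro prob_abs_ge) auto
  finally show ?thesis by simp
qed

lemma sample_miss:
  assumes "n > 0"
  shows "measure_pmf.prob (sample s n) {xs. \<forall>x \<in> set xs. \<not> Q x}
    \<le> exp (- (real s * real (card {x \<in> {..<n}. Q x}) / real n))"
proof -
  let ?q = "real (card {x \<in> {..<n}. Q x}) / real n"
  have "card {x \<in> {..<n}. Q x} \<le> card {..<n}" by (intro card_mono) auto
  then have q: "0 \<le> ?q" "?q \<le> 1" using assms by (auto simp: field_simps)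
  have "{xs. \<forall>x \<in> set xs. \<not> Q x} = (\<lambda>xs. length (filter Q xs)) -` {0}"
    by (auto simp: filter_empty_conv)
  then have "measure_pmf.prob (sample s n) {xs. \<forall>x \<in> set xs. \<not> Q x} =
    measure_pmf.prob (map_pmf (\<lambda>xs. length (filter Q xs)) (sample s n)) {0}"
    by simp
  also have "\<dots> = (1 - ?q) ^ s"
    unfolding sample_count[OF assms] using q by (simp add: measure_pmf_single)
  also have "\<dots> \<le> exp (- ?q) ^ s"
    using q exp_ge_add_one_self[of "- ?q"] by (intro power_mono) auto
  also have "\<dots> = exp (- (real s * real (card {x \<in> {..<n}. Q x}) / real n))"
    by (simp add: exp_of_nat_mult[symmetric])
  finally show ?thesis .
qed

lemma prob_union_bound:
  "measure_pmf.prob M {x. P x \<or> Q x} \<le> measure_pmf.prob M {x. P x} + measure_pmf.prob M {x. Q x}"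
  using measure_Un_le[of "{x. P x}" M "{x. Q x}"] by (simp add: Un_def)

section \<open>Events under which the samples serve their purpose\<close>

definition good_sample :: "nat \<Rightarrow> (nat \<Rightarrow> nat) \<Rightarrow> nat \<Rightarrow> real \<Rightarrow> nat list \<Rightarrow> bool" where
  "good_sample n rk t d S \<longleftrightarrow> (\<forall>m \<in> {n div 2, n div 2 - t, n div 2 + t}.
     \<bar>real (rank_count rk S m) - real (length S) * real m / real n\<bar> < d)"

text \<open>A union bound over the three ranks, each with Hoeffding error \<open>2 / n\<close>. As
  \<open>good_sample\<close> normalises by \<open>length S\<close>, the premise
  \<open>length S = s\<close> ties it to \<open>s\<close> on lists outside the support, too.\<close>

lemma prob_good_sample:
  assumes rk: "rk permutes {..<n}" and n: "n > 0" "s > 0" "d \<ge> 0" "t \<le> n div 2"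
    and d: "exp (- 2 * d\<^sup>2 / real s) \<le> 1 / real n"
  shows "measure_pmf.prob (sample s n) {S. \<not> (length S = s \<longrightarrow> good_sample n rk t d S)} \<le> 6 / real n"
proof -
  let ?P = "\<lambda>m S. d \<le> \<bar>real (rank_count rk S m) - real s * real m / real n\<bar>"
  have P: "measure_pmf.prob (sample s n) {S. ?P m S} \<le> 2 / real n" if "m \<le> n" for m
  proof -
    have "measure_pmf.prob (sample s n) {S. ?P m S} \<le> 2 * exp (- 2 * d\<^sup>2 / real s)"
      using sample_deviation[OF n(1,2,3), of "\<lambda>x. rk x < m"]
      unfolding card_rank_less[OF rk that] rank_count_def .
    then show ?thesis using d by simp
  qed
  have "{S. \<not> (length S = s \<longrightarrow> good_sample n rk t d S)} \<subseteq>
      {S. ?P (n div 2) S \<or> ?P (n div 2 - t) S \<or> ?P (n div 2 + t) S}"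
    by (auto simp: good_sample_def not_less)
  then have "measure_pmf.prob (sample s n) {S. \<not> (length S = s \<longrightarrow> good_sample n rk t d S)} \<le>
      measure_pmf.prob (sample s n) {S. ?P (n div 2) S \<or> ?P (n div 2 - t) S \<or> ?P (n div 2 + t) S}"
    by (intro measure_pmf.finite_measure_mono) auto
  also have "\<dots> \<le> 2 / real n + (2 / real n + 2 / real n)"
    using n by (intro order_trans[OF prob_union_bound] add_mono P) auto
  finally show ?thesis by simp
qed

text \<open>The thresholds sit \<open>d\<close> below the expected counts at the middle. Moving
  \<open>t\<close> ranks away changes the expectation by at least \<open>2 * d\<close>, so
  deviations less than \<open>d\<close> cannot blur the two positions.\<close>

lemma good_sample_pivots:
  assumes "good_sample n rk t d S" "n > 0" "t \<le> n div 2" "2 * d \<le> real (length S) * real t / real n"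
  defines "a \<equiv> real (length S) * real (n div 2) / real n - d"
    and "a' \<equiv> real (length S) - real (length S) * real (n div 2) / real n - d"
  shows "a \<le> real (rank_count rk S (n div 2))" "real (rank_count rk S (n div 2 - t)) < a"
    "a' \<le> real (length S) - real (rank_count rk S (n div 2))"
    "real (length S) - real (rank_count rk S (n div 2 + t)) < a'"
proof -
  define q where "q = real (length S) / real n"
  have eq: "real (length S) * x / real n = q * x" for x by (simp add: q_def)
  have g: "\<bar>real (rank_count rk S m) - q * real m\<bar> < d" if "m \<in> {n div 2, n div 2 - t, n div 2 + t}" for m
    using assms(1) that unfolding good_sample_def eq by blast
  have t: "2 * d \<le> q * real t" using assms(4) by (simp add: eq)
  have m1: "q * real (n div 2 - t) = q * real (n div 2) - q * real t"
    using assms(3) by (simp add: of_nat_diff right_diff_distrib)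
  have m2: "q * real (n div 2 + t) = q * real (n div 2) + q * real t"
    by (simp add: distrib_left)
  show "a \<le> real (rank_count rk S (n div 2))" "a' \<le> real (length S) - real (rank_count rk S (n div 2))"
    using g[of "n div 2"] unfolding a_def a'_def eq by auto
  show "real (rank_count rk S (n div 2 - t)) < a"
    using g[of "n div 2 - t"] t unfolding a_def eq m1 by auto
  show "real (length S) - real (rank_count rk S (n div 2 + t)) < a'"
    using g[of "n div 2 + t"] t unfolding a'_def eq m2 by auto
qed

text \<open>The event ranges over all lists, hence the premise
  \<open>set V \<subseteq> {..<n}\<close>, which holds for every list drawn by
  \<open>sample\<close>.\<close>

definition good_pivots :: "nat \<Rightarrow> (nat \<Rightarrow> nat) \<Rightarrow> nat \<Rightarrow> nat \<Rightarrow> real \<Rightarrow> nat list \<Rightarrow> bool" where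
  "good_pivots n rk t t' c V \<longleftrightarrow> (set V \<subseteq> {..<n} \<longrightarrow> covers n rk t' V) \<and> real (window_count n rk t V) \<le> c"

text \<open>Hoeffding bounds the number of members in the old window with error
  \<open>2 / n\<close>; missing the left or the right half of the new window costs
  \<open>1 / n\<close> each.\<close>

lemma prob_good_pivots:
  assumes rk: "rk permutes {..<n}" and n: "n > 0" "v > 0" "d \<ge> 0" "t \<le> n div 2" "t' \<le> n div 2"
    and d: "exp (- 2 * d\<^sup>2 / real v) \<le> 1 / real n"
    and t': "exp (- (real v * real t' / real n)) \<le> 1 / real n"
    and c: "c = real v * real (2 * t) / real n + d"
  shows "measure_pmf.prob (sample v n) {V. \<not> good_pivots n rk t t' c V} \<le> 4 / real n"
proof -
  let ?h = "n div 2"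
  let ?N = "\<lambda>V. d \<le> \<bar>real (window_count n rk t V) - real v * real (2 * t) / real n\<bar>"
  let ?L = "\<lambda>V. \<forall>x \<in> set V. \<not> (?h - t' \<le> rk x \<and> rk x < ?h)"
  let ?U = "\<lambda>V. \<forall>x \<in> set V. \<not> (?h \<le> rk x \<and> rk x < ?h + t')"
  have N: "measure_pmf.prob (sample v n) {V. ?N V} \<le> 2 / real n"
  proof -
    have "{x \<in> {..<n}. ?h \<le> rk x + t \<and> rk x < ?h + t} = {x \<in> {..<n}. ?h - t \<le> rk x \<and> rk x < ?h + t}"
      by auto
    also have "card \<dots> = 2 * t"
      using n by (subst card_rank_in[OF rk]) auto
    finally have card: "card {x \<in> {..<n}. ?h \<le> rk x + t \<and> rk x < ?h + t} = 2 * t" .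
    have "measure_pmf.prob (sample v n) {V. ?N V} \<le> 2 * exp (- 2 * d\<^sup>2 / real v)"
      using sample_deviation[OF n(1,2,3), of "\<lambda>x. ?h \<le> rk x + t \<and> rk x < ?h + t"]
      unfolding card window_count_def .
    then show ?thesis using d by simp
  qed
  have L: "measure_pmf.prob (sample v n) {V. ?L V} \<le> 1 / real n"
  proof -
    have "card {x \<in> {..<n}. ?h - t' \<le> rk x \<and> rk x < ?h} = t'"
      using n by (subst card_rank_in[OF rk]) auto
    then show ?thesis
      using sample_miss[OF n(1), of v "\<lambda>x. ?h - t' \<le> rk x \<and> rk x < ?h"] t' by (auto intro: order_trans)
  qed
  have U: "measure_pmf.prob (sample v n) {V. ?U V} \<le> 1 / real n"
  proof -
    have "card {x \<in> {..<n}. ?h \<le> rk x \<and> rk x < ?h + t'} = t'"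
      using n by (subst card_rank_in[OF rk]) auto
    then show ?thesis
      using sample_miss[OF n(1), of v "\<lambda>x. ?h \<le> rk x \<and> rk x < ?h + t'"] t' by (auto intro: order_trans)
  qed
  have "good_pivots n rk t t' c V" if V: "\<not> (?N V \<or> ?L V \<or> ?U V)" for V
  proof -
    \<comment> \<open>One hit in each half suffices: it lies between the middle and everything
      beyond the window on its side.\<close>
    obtain x y where x: "x \<in> set V" "?h - t' \<le> rk x" "rk x < ?h"
      and y: "y \<in> set V" "?h \<le> rk y" "rk y < ?h + t'"
      using V by blast
    have "real (window_count n rk t V) \<le> c" using V unfolding c by linarith
    moreover have "\<exists>v\<in>set V. rk z \<le> rk v \<and> rk v < ?h" if "rk z + t' < ?h" for z
      using x that by (intro bexI[of _ x]) auto
    moreover have "\<exists>v\<in>set V. ?h \<le> rk v \<and> rk v \<le> rk z" if "?h + t' \<le> rk z" for z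
      using y that by (intro bexI[of _ y]) auto
    ultimately show ?thesis
      by (auto simp: good_pivots_def covers_def)
  qed
  then have "measure_pmf.prob (sample v n) {V. \<not> good_pivots n rk t t' c V} \<le>
      measure_pmf.prob (sample v n) {V. ?N V \<or> ?L V \<or> ?U V}"
    by (intro measure_pmf.finite_measure_mono) auto
  also have "\<dots> \<le> 2 / real n + (1 / real n + 1 / real n)"
    by (intro order_trans[OF prob_union_bound] add_mono N L U)
  finally show ?thesis by simp
qed

section \<open>The choice of exponents and the randomized algorithm\<close>

definition power_floor :: "real \<Rightarrow> nat \<Rightarrow> nat" where
  "power_floor e n = nat \<lfloor>real n powr e\<rfloor>"

text \<open>
  A sample of \<open>n powr a\<close> elements hits every window of \<open>n powr b\<close> ranks with high probability if
  \<open>a + b > 1\<close>; it has \<open>O(n powr (a + b - 1) + n powr c)\<close> members in such a window if \<open>c > a / 2\<close>.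
  The exponents are chosen such that the windows shrink from \<open>0.8\<close> to \<open>0.65\<close> to \<open>0.41\<close> and each round
  needs at most \<open>n / ln n\<close> comparisons.
\<close>

definition select_alg :: "real \<Rightarrow> nat \<Rightarrow> rand_alg" where
  "select_alg \<gamma> n =
     bind_pmf (sample (power_floor 0.45 n) n) (\<lambda>S.
     bind_pmf (sample (power_floor 0.36 n) n) (\<lambda>V1.
     bind_pmf (sample (power_floor 0.6 n) n) (\<lambda>V2.
       return_pmf (partition_alg n (reps \<gamma> (4 * ln (real n)))
         (map (\<lambda>i. reps \<gamma> (4 * real (tower i))) [0..<Suc (log_star (real n))])
         (real (length S) * real (n div 2) / real n - real n powr 0.24)
         (real (length S) - real (length S) * real (n div 2) / real n - real n powr 0.24)
         S V1 V2))))"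

lemma valid_select_alg: "a \<in> set_pmf (select_alg \<gamma> n) \<Longrightarrow> valid_alg n a"
  unfolding select_alg_def by (auto simp: valid_partition_alg)

text \<open>Up to constants and logarithms these are comparisons of exponents, the narrow ones being
  \<open>0.24 < 0.45 + 0.8 - 1\<close>, \<open>0.36 < 2 * 0.19\<close>,
  \<open>0.6 < 2 * 0.31\<close>, \<open>1 < 0.36 + 0.65\<close>, \<open>1 < 0.6 + 0.41\<close> and
  \<open>0.8 + 0.19 < 1\<close>. The bounds by \<open>n / 2 - 1\<close> make the half-widths at most
  \<open>n div 2\<close>.\<close>

definition large :: "nat \<Rightarrow> bool" where
  "large n \<longleftrightarrow> n \<ge> 5 \<and>
     power_floor 0.45 n > 0 \<and> power_floor 0.36 n > 0 \<and> power_floor 0.6 n > 0 \<and>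
     real (power_floor 0.8 n) \<le> real n / 2 - 1 \<and>
     real (power_floor 0.65 n) \<le> real n / 2 - 1 \<and>
     real (power_floor 0.41 n) \<le> real n / 2 - 1 \<and>
     (real (power_floor 0.45 n))\<^sup>2 * ln (real n) \<le> real n \<and>
     2 * real n powr 0.24 \<le> real (power_floor 0.45 n) * real (power_floor 0.8 n) / real n \<and>
     exp (- 2 * (real n powr 0.24)\<^sup>2 / real (power_floor 0.45 n)) \<le> 1 / real n \<and>
     exp (- 2 * (real n powr 0.19)\<^sup>2 / real (power_floor 0.36 n)) \<le> 1 / real n \<and>
     exp (- 2 * (real n powr 0.31)\<^sup>2 / real (power_floor 0.6 n)) \<le> 1 / real n \<and>
     exp (- (real (power_floor 0.36 n) * real (power_floor 0.65 n) / real n)) \<le> 1 / real n \<and>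
     exp (- (real (power_floor 0.6 n) * real (power_floor 0.41 n) / real n)) \<le> 1 / real n \<and>
     2 * real (power_floor 0.8 n) * (real (power_floor 0.36 n) * real (2 * power_floor 0.8 n) / real n
       + real n powr 0.19) * ln (real n) \<le> real n \<and>
     2 * real (power_floor 0.65 n) * (real (power_floor 0.6 n) * real (2 * power_floor 0.65 n) / real n
       + real n powr 0.31) * ln (real n) \<le> real n \<and>
     4 * (real (power_floor 0.41 n))\<^sup>2 * ln (real n) \<le> real n"

lemma eventually_large: "eventually large sequentially"
  unfolding large_def power_floor_def of_nat_mult
  by (intro eventually_conj eventually_ge_at_top; real_asymp)

lemma success_select_alg:
  assumes rk: "rk permutes {..<n}" and \<gamma>: "0 < \<gamma>" "\<gamma> \<le> 1" and n: "large n"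
  shows "measure_pmf.prob (bind_pmf (select_alg \<gamma> n) (run \<gamma> rk))
     {out. rounds out \<le> log_star (real n) + 5 \<and> real (queries out) \<le> 192 * real n / \<gamma> \<and>
           solves_partition n rk out} \<ge> 1 - 19 / real n"
    (is "measure_pmf.prob _ ?X \<ge> _")
proof -
  note n = n[unfolded large_def]
  define s t d where "s = power_floor 0.45 n" and "t = power_floor 0.8 n" and "d = real n powr 0.24"
  define v1 t1 c1 where "v1 = power_floor 0.36 n" and "t1 = power_floor 0.65 n"
    and "c1 = real v1 * real (2 * t) / real n + real n powr 0.19"
  define v2 t2 c2 where "v2 = power_floor 0.6 n" and "t2 = power_floor 0.41 n"
    and "c2 = real v2 * real (2 * t1) / real n + real n powr 0.31"
  have n0: "n > 0" using n by simp
  have t: "t \<le> n div 2" "t1 \<le> n div 2" "t2 \<le> n div 2"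
    using n unfolding t_def t1_def t2_def by linarith+
  define A where "A = (\<lambda>S V1 V2. partition_alg n (reps \<gamma> (4 * ln (real n)))
         (map (\<lambda>i. reps \<gamma> (4 * real (tower i))) [0..<Suc (log_star (real n))])
         (real (length S) * real (n div 2) / real n - d)
         (real (length S) - real (length S) * real (n div 2) / real n - d) S V1 V2)"
  have success: "measure_pmf.prob (run \<gamma> rk (A S V1 V2)) ?X \<ge> 1 - 5 / real n"
    if S: "S \<in> set_pmf (sample s n)" "length S = s \<longrightarrow> good_sample n rk t d S"
      and V1: "V1 \<in> set_pmf (sample v1 n)" "good_pivots n rk t t1 c1 V1"
      and V2: "V2 \<in> set_pmf (sample v2 n)" "good_pivots n rk t1 t2 c2 V2" for S V1 V2
  proof -
    have len: "length S = s" using sample_set[OF n0 S(1)] by simp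
    have "2 * d \<le> real (length S) * real t / real n"
      using n by (simp add: len s_def t_def d_def)
    note piv = good_sample_pivots[OF S(2)[rule_format, OF len] n0 t(1) this]
    have "success \<gamma> n rk (log_star (real n) + 5) (192 * real n / \<gamma>) (5 / real n) (A S V1 V2)"
      unfolding A_def
      using n V1(2) V2(2) sample_set[OF n0 V1(1)] sample_set[OF n0 V2(1)]
      by (intro success_partition_alg[OF rk \<gamma> _ sample_set(1)[OF n0 S(1)] _ piv, of t1 V1 c1 t2 V2 c2] t)
         (simp_all only: good_pivots_def len s_def t_def t1_def t2_def c1_def c2_def v1_def v2_def)
    then show ?thesis by (simp add: success_def)
  qed
  have "bind_pmf (select_alg \<gamma> n) (run \<gamma> rk) =
      bind_pmf (sample s n) (\<lambda>S. bind_pmf (sample v1 n) (\<lambda>V1. bind_pmf (sample v2 n) (\<lambda>V2.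
        run \<gamma> rk (A S V1 V2))))"
    by (simp add: select_alg_def bind_assoc_pmf bind_return_pmf A_def s_def v1_def v2_def d_def)
  \<comment> \<open>The total 19 consists of 6 for \<open>S\<close>, 4 for each of \<open>V1\<close>
    and \<open>V2\<close>, and 5 for the erasures.\<close>
  moreover have "measure_pmf.prob \<dots> ?X \<ge> 1 - (((5 / real n + 4 / real n) + 4 / real n) + 6 / real n)"
  proof (rule prob_bind_pmf_ge)
    show "measure_pmf.prob (sample s n) {S. \<not> (length S = s \<longrightarrow> good_sample n rk t d S)} \<le> 6 / real n"
      using n t by (intro prob_good_sample rk) (auto simp: s_def d_def)
    fix S assume S: "S \<in> set_pmf (sample s n)" "length S = s \<longrightarrow> good_sample n rk t d S"
    show "1 - ((5 / real n + 4 / real n) + 4 / real n) \<le>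
       measure_pmf.prob (bind_pmf (sample v1 n) (\<lambda>V1. bind_pmf (sample v2 n) (\<lambda>V2. run \<gamma> rk (A S V1 V2)))) ?X"
    proof (rule prob_bind_pmf_ge)
      show "measure_pmf.prob (sample v1 n) {V. \<not> good_pivots n rk t t1 c1 V} \<le> 4 / real n"
        using n t by (intro prob_good_pivots[OF rk, where d = "real n powr 0.19"]) (auto simp: v1_def t1_def c1_def)
      fix V1 assume V1: "V1 \<in> set_pmf (sample v1 n)" "good_pivots n rk t t1 c1 V1"
      show "1 - (5 / real n + 4 / real n) \<le>
         measure_pmf.prob (bind_pmf (sample v2 n) (\<lambda>V2. run \<gamma> rk (A S V1 V2))) ?X"
      proof (rule prob_bind_pmf_ge)
        show "measure_pmf.prob (sample v2 n) {V. \<not> good_pivots n rk t1 t2 c2 V} \<le> 4 / real n"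
          using n t by (intro prob_good_pivots[OF rk, where d = "real n powr 0.31"]) (auto simp: v2_def t2_def c2_def)
        fix V2 assume V2: "V2 \<in> set_pmf (sample v2 n)" "good_pivots n rk t1 t2 c2 V2"
        show "1 - 5 / real n \<le> measure_pmf.prob (run \<gamma> rk (A S V1 V2)) ?X"
          by (rule success[OF S V1 V2])
      qed simp
    qed simp
  qed simp
  ultimately show ?thesis by (simp add: add_divide_distrib[symmetric])
qed

theorem theorem9:
  "\<exists>(alg :: real \<Rightarrow> nat \<Rightarrow> rand_alg) (C :: real) (p :: real poly).
     C > 0 \<and> degree p > 0 \<and> lead_coeff p > 0 \<and>
     (\<forall>\<^sub>F n :: nat in sequentially. \<forall>\<gamma> :: real. 0 < \<gamma> \<and> \<gamma> \<le> 1 \<longrightarrow>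
        (\<forall>a \<in> set_pmf (alg \<gamma> n). valid_alg n a) \<and>
        measure_pmf.prob (joint_pmf \<gamma> n (alg \<gamma> n))
          {(rk, out). real (queries out) \<le> C * (real n / \<gamma>) \<and>
                      rounds out \<le> log_star (real n) + 8 \<and>
                      solves_partition n rk out}
          \<ge> 1 - 1 / poly p (real n))"
proof (intro exI conjI)
  \<comment> \<open>The polynomial \<open>x / 19\<close>, so that \<open>1 / poly ?p n\<close> is
    the error \<open>19 / n\<close>.\<close>
  let ?p = "[:0, 1 / 19:] :: real poly"
  show "(192 :: real) > 0" "degree ?p > 0" "lead_coeff ?p > 0" by simp_all
  show "\<forall>\<^sub>F n :: nat in sequentially. \<forall>\<gamma> :: real. 0 < \<gamma> \<and> \<gamma> \<le> 1 \<longrightarrow>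
        (\<forall>a \<in> set_pmf (select_alg \<gamma> n). valid_alg n a) \<and>
        measure_pmf.prob (joint_pmf \<gamma> n (select_alg \<gamma> n))
          {(rk, out). real (queries out) \<le> 192 * (real n / \<gamma>) \<and>
                      rounds out \<le> log_star (real n) + 8 \<and>
                      solves_partition n rk out}
          \<ge> 1 - 1 / poly ?p (real n)"
    using eventually_large
  proof eventually_elim
    case (elim n)
    show ?case
    proof (intro allI impI conjI ballI)
      fix \<gamma> :: real and a assume "a \<in> set_pmf (select_alg \<gamma> n)"
      then show "valid_alg n a" by (rule valid_select_alg)
    next
      fix \<gamma> :: real assume \<gamma>: "0 < \<gamma> \<and> \<gamma> \<le> 1"
      let ?X = "{(rk, out). real (queries out) \<le> 192 * (real n / \<gamma>) \<and>
                      rounds out \<le> log_star (real n) + 8 \<and> solves_partition n rk out}"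
      have "measure_pmf.prob (joint_pmf \<gamma> n (select_alg \<gamma> n)) ?X \<ge> 1 - (19 / real n + 0)"
        unfolding joint_pmf_def
      \<comment> \<open>No order is bad: the bound holds for each \<open>rk\<close>, hence also on
        average.\<close>
      proof (rule prob_bind_pmf_ge[where good = "\<lambda>_. True"])
        fix rk assume "rk \<in> set_pmf (pmf_of_set {rk. rk permutes {..<n}})"
        moreover have "{rk. rk permutes {..<n}} \<noteq> {}"
          using permutes_id[of "{..<n}"] by blast
        ultimately have rk: "rk permutes {..<n}"
          by (simp add: finite_permutations)
        have eq: "bind_pmf (select_alg \<gamma> n) (\<lambda>a. map_pmf (\<lambda>out. (rk, out)) (run \<gamma> rk a)) =
            map_pmf (\<lambda>out. (rk, out)) (bind_pmf (select_alg \<gamma> n) (run \<gamma> rk))"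
          by (simp add: map_bind_pmf)
        have "1 - 19 / real n \<le> measure_pmf.prob (bind_pmf (select_alg \<gamma> n) (run \<gamma> rk))
           {out. rounds out \<le> log_star (real n) + 5 \<and> real (queries out) \<le> 192 * real n / \<gamma> \<and>
                 solves_partition n rk out}"
          using \<gamma> elim by (intro success_select_alg rk) auto
        also have "\<dots> \<le> measure_pmf.prob (bind_pmf (select_alg \<gamma> n) (run \<gamma> rk)) ((\<lambda>out. (rk, out)) -` ?X)"
          by (intro measure_pmf.finite_measure_mono) auto
        finally show "1 - 19 / real n \<le> measure_pmf.prob
            (bind_pmf (select_alg \<gamma> n) (\<lambda>a. map_pmf (\<lambda>out. (rk, out)) (run \<gamma> rk a))) ?X"
          unfolding eq by simp
      qed auto
      then show "measure_pmf.prob (joint_pmf \<gamma> n (select_alg \<gamma> n)) ?X \<ge> 1 - 1 / poly ?p (real n)"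
        by simp
    qed
  qed
qed

end
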